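(* Let $[\mathbf G,\mathbf o]$ be a unimodular network and let $w_i:\mathcal G_*\to\mathbb R^{\ge0}$ be measurable functions for $i=1,2$. Assume $\mathbb E[w_1[\mathbf G,\mathbf o]\mid I]<\infty$ a.s. Then the following are equivalent. (i) There is an invariant transport kernel that almost surely balances between the functions $w_1[\mathbf G,\cdot]$ and $w_2[\mathbf G,\cdot]$ on the vertices; i.e. there is a measurable function $T:\mathcal G_{**}\to\mathbb R^{\ge0}$ such that almost surely, $T^+_{\mathbf G}(v)=w_1[\mathbf G,v]$ and $T^-_{\mathbf G}(v)=w_2[\mathbf G,v]$ for all $v\in V(\mathbf G)$. (ii) $\mathbb E[w_1[\mathbf G,\mathbf o]\mid I]=\mathbb E[w_2[\mathbf G,\mathbf o]\mid I]$ a.s.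
   Context: Networks. Fix a complete separable metric space $\Xi$ (the mark space). A network is a connected, locally finite (every vertex has finite degree) multigraph $G$ with vertex set $V(G)$, together with a mark in $\Xi$ for each vertex $v$ and for each pair $(v,e)$ with $e$ an edge incident to $v$. A rooted network $(G,o)$ is a network with a distinguished vertex $o$; a doubly-rooted network $(G,o,v)$ has an ordered pair of distinguished vertices. Isomorphisms preserve marks and distinguished vertices. $\mathcal G_*$ and $\mathcal G_{**}$ are the sets of isomorphism classes $[G,o]$ and $[G,o,v]$ of rooted and doubly-rooted networks, with their Borel sigma-fields for the (Polish) local topologies: $[G_n,o_n]\to[G,o]$ iff for all $r\in\mathbb N$ and $\varepsilon>0$, for all large $n$ there is a graph isomorphism between the balls of radius $r$ about the roots that maps root to root and for which corresponding marks are at distance less than $\varepsilon$; for $\mathcal G_{**}$ one uses balls about the first root, with $r$ at least the distance of the two roots in the limit, and isomorphisms must also map second root to second root. For a function $f$ we write $f[G,o]$ for $f([G,o])$, etc. A random rooted network $[\mathbf G,\mathbf o]$ is a random element of $\mathcal G_*$. For $T:\mathcal G_{**}\to\mathbb R^{\ge0}$ measurable (an invariant transport kernel), $T_G(u,v)=T[G,u,v]$, $T_G^+(o)=\sum_{v\in V(G)}T_G(o,v)$, $T_G^-(o)=\sum_{v\in V(G)}T_G(v,o)$. Unimodular: $[\mathbf G,\mathbf o]$ is unimodular (a "unimodular network") if for all measurable $g:\mathcal G_{**}\to\mathbb R^{\ge0}$, $\mathbb E[g_{\mathbf G}^+(\mathbf o)]=\mathbb E[g_{\mathbf G}^-(\mathbf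 o)]$ (both sides may be infinite). Invariant sigma-field $I$: the family of measurable $A\subseteq\mathcal G_*$ such that $[G,o]\in A$ and $v\in V(G)$ imply $[G,v]\in A$. $\mathbb E[\,\cdot\mid I]$ denotes conditional expectation given the sigma-field of events $\{[\mathbf G,\mathbf o]\in A\}$, $A\in I$. *)

theory Defs
  imports "HOL-Probability.Probability"
begin

section \<open>Networks\<close>

text \<open>
  Loops and multiple edges are allowed: \<open>ends G e\<close> is the set of the one or two endpoints
  of the edge \<open>e\<close>. The values of \<open>ends\<close>, \<open>vmark\<close> and \<open>emark\<close> off the vertices, edges and
  incident pairs are irrelevant junk that isomorphisms ignore.
\<close>

record ('v, 'e, 'm) network =
  verts :: "'v set"
  edges :: "'e set"
  ends :: "'e \<Rightarrow> 'v set"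
  vmark :: "'v \<Rightarrow> 'm"
  emark :: "'v \<Rightarrow> 'e \<Rightarrow> 'm"

definition adj :: "('v, 'e, 'm) network \<Rightarrow> ('v \<times> 'v) set" where
  "adj G = {(u, v). \<exists>e\<in>edges G. ends G e = {u, v}}"

definition is_network :: "('v, 'e, 'm) network \<Rightarrow> bool" where
  "is_network G \<longleftrightarrow>
     (\<forall>e\<in>edges G. \<exists>u\<in>verts G. \<exists>v\<in>verts G. ends G e = {u, v}) \<and>
     (\<forall>v\<in>verts G. finite {e \<in> edges G. v \<in> ends G e}) \<and>
     (\<forall>u\<in>verts G. \<forall>v\<in>verts G. (u, v) \<in> (adj G)\<^sup>*)"

definition graph_iso ::
    "('v \<Rightarrow> 'w) \<Rightarrow> ('e \<Rightarrow> 'f) \<Rightarrow> ('v, 'e, 'm) network \<Rightarrow> ('w, 'f, 'm) network \<Rightarrow> bool" where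
  "graph_iso \<phi> \<psi> G H \<longleftrightarrow>
     bij_betw \<phi> (verts G) (verts H) \<and> bij_betw \<psi> (edges G) (edges H) \<and>
     (\<forall>e\<in>edges G. ends H (\<psi> e) = \<phi> ` ends G e)"

definition marks_rel ::
    "('m \<Rightarrow> 'm \<Rightarrow> bool) \<Rightarrow> ('v \<Rightarrow> 'w) \<Rightarrow> ('e \<Rightarrow> 'f) \<Rightarrow>
     ('v, 'e, 'm) network \<Rightarrow> ('w, 'f, 'm) network \<Rightarrow> bool" where
  "marks_rel R \<phi> \<psi> G H \<longleftrightarrow>
     (\<forall>v\<in>verts G. R (vmark G v) (vmark H (\<phi> v))) \<and>
     (\<forall>e\<in>edges G. \<forall>v\<in>ends G e. R (emark G v e) (emark H (\<phi> v) (\<psi> e)))"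

definition network_iso ::
    "('v \<Rightarrow> 'w) \<Rightarrow> ('e \<Rightarrow> 'f) \<Rightarrow> ('v, 'e, 'm) network \<Rightarrow> ('w, 'f, 'm) network \<Rightarrow> bool" where
  "network_iso \<phi> \<psi> G H \<longleftrightarrow> graph_iso \<phi> \<psi> G H \<and> marks_rel (=) \<phi> \<psi> G H"

definition ball_verts :: "('v, 'e, 'm) network \<Rightarrow> 'v \<Rightarrow> nat \<Rightarrow> 'v set" where
  "ball_verts G u r = {v. \<exists>n\<le>r. (u, v) \<in> adj G ^^ n}"

definition net_ball :: "('v, 'e, 'm) network \<Rightarrow> 'v \<Rightarrow> nat \<Rightarrow> ('v, 'e, 'm) network" where
  "net_ball G u r =
     G\<lparr>verts := ball_verts G u r, edges := {e \<in> edges G. ends G e \<subseteq> ball_verts G u r}\<rparr>"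


section \<open>Isomorphism classes of rooted and doubly-rooted networks\<close>

fun rooted_network :: "('v, 'e, 'm) network \<times> 'v \<Rightarrow> bool" where
  "rooted_network (G, u) \<longleftrightarrow> is_network G \<and> u \<in> verts G"

fun birooted_network :: "('v, 'e, 'm) network \<times> 'v \<times> 'v \<Rightarrow> bool" where
  "birooted_network (G, u, v) \<longleftrightarrow> is_network G \<and> u \<in> verts G \<and> v \<in> verts G"

fun rooted_iso :: "('v, 'e, 'm) network \<times> 'v \<Rightarrow> ('w, 'f, 'm) network \<times> 'w \<Rightarrow> bool" where
  "rooted_iso (G, u) (H, w) \<longleftrightarrow>
     rooted_network (G, u) \<and> rooted_network (H, w) \<and>
     (\<exists>\<phi> \<psi>. network_iso \<phi> \<psi> G H \<and> \<phi> u = w)"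

fun birooted_iso ::
    "('v, 'e, 'm) network \<times> 'v \<times> 'v \<Rightarrow> ('w, 'f, 'm) network \<times> 'w \<times> 'w \<Rightarrow> bool" where
  "birooted_iso (G, u, v) (H, w, z) \<longleftrightarrow>
     birooted_network (G, u, v) \<and> birooted_network (H, w, z) \<and>
     (\<exists>\<phi> \<psi>. network_iso \<phi> \<psi> G H \<and> \<phi> u = w \<and> \<phi> v = z)"

lemma network_ends_subset: "is_network G \<Longrightarrow> e \<in> edges G \<Longrightarrow> ends G e \<subseteq> verts G"
  by (fastforce simp: is_network_def)

lemma graph_iso_id: "graph_iso id id G G"
  by (auto simp: graph_iso_def)

lemma graph_iso_trans:
  assumes "graph_iso \<phi> \<psi> G H" "graph_iso \<phi>' \<psi>' H K"
  shows "graph_iso (\<phi>' \<circ> \<phi>) (\<psi>' \<circ> \<psi>) G K"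
  using assms by (auto simp: graph_iso_def image_comp intro: bij_betw_trans dest: bij_betwE)

lemma marks_rel_trans:
  assumes "graph_iso \<phi> \<psi> G H" "marks_rel R \<phi> \<psi> G H" "marks_rel S \<phi>' \<psi>' H K"
    and "\<And>x y z. R x y \<Longrightarrow> S y z \<Longrightarrow> T x z"
  shows "marks_rel T (\<phi>' \<circ> \<phi>) (\<psi>' \<circ> \<psi>) G K"
  unfolding marks_rel_def o_def
proof (intro conjI ballI)
  fix v assume "v \<in> verts G"
  then show "T (vmark G v) (vmark K (\<phi>' (\<phi> v)))"
    using assms by (meson graph_iso_def marks_rel_def bij_betwE)
next
  fix e v assume e: "e \<in> edges G" "v \<in> ends G e"
  then have "\<psi> e \<in> edges H" "\<phi> v \<in> ends H (\<psi> e)"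
    using assms(1) by (auto simp: graph_iso_def dest: bij_betwE)
  then show "T (emark G v e) (emark K (\<phi>' (\<phi> v)) (\<psi>' (\<psi> e)))"
    using assms(2-4) e unfolding marks_rel_def by blast
qed

lemma graph_iso_sym:
  assumes "graph_iso \<phi> \<psi> G H" "\<And>e. e \<in> edges G \<Longrightarrow> ends G e \<subseteq> verts G"
  shows "graph_iso (inv_into (verts G) \<phi>) (inv_into (edges G) \<psi>) H G"
  unfolding graph_iso_def
proof (intro conjI ballI)
  have p: "bij_betw \<phi> (verts G) (verts H)" and q: "bij_betw \<psi> (edges G) (edges H)"
    using assms by (auto simp: graph_iso_def)
  show "bij_betw (inv_into (verts G) \<phi>) (verts H) (verts G)"
    "bij_betw (inv_into (edges G) \<psi>) (edges H) (edges G)"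
    using p q by (auto intro: bij_betw_inv_into)
  fix f assume f: "f \<in> edges H"
  let ?e = "inv_into (edges G) \<psi> f"
  have e: "?e \<in> edges G" "\<psi> ?e = f"
    using q f by (auto simp: bij_betw_def inv_into_into f_inv_into_f)
  then have "ends H f = \<phi> ` ends G ?e"
    using assms(1) by (metis graph_iso_def)
  then show "ends G ?e = inv_into (verts G) \<phi> ` ends H f"
    using p assms(2)[OF e(1)] by (simp add: bij_betw_def inv_into_image_cancel)
qed

lemma marks_rel_sym:
  assumes g: "graph_iso \<phi> \<psi> G H" and s: "\<And>e. e \<in> edges G \<Longrightarrow> ends G e \<subseteq> verts G"
    and m: "marks_rel R \<phi> \<psi> G H" and R: "\<And>x y. R x y \<Longrightarrow> R y x"
  shows "marks_rel R (inv_into (verts G) \<phi>) (inv_into (edges G) \<psi>) H G"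
  unfolding marks_rel_def
proof (intro conjI ballI)
  have p: "bij_betw \<phi> (verts G) (verts H)" and q: "bij_betw \<psi> (edges G) (edges H)"
    using g by (auto simp: graph_iso_def)
  fix w assume "w \<in> verts H"
  then have "inv_into (verts G) \<phi> w \<in> verts G" "\<phi> (inv_into (verts G) \<phi> w) = w"
    using p by (auto simp: bij_betw_def inv_into_into f_inv_into_f)
  then show "R (vmark H w) (vmark G (inv_into (verts G) \<phi> w))"
    using m R unfolding marks_rel_def by metis
next
  have p: "bij_betw \<phi> (verts G) (verts H)" and q: "bij_betw \<psi> (edges G) (edges H)"
    using g by (auto simp: graph_iso_def)
  fix f w assume f: "f \<in> edges H" and w: "w \<in> ends H f"
  let ?e = "inv_into (edges G) \<psi> f" and ?v = "inv_into (verts G) \<phi> w"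
  have e: "?e \<in> edges G" "\<psi> ?e = f"
    using q f by (auto simp: bij_betw_def inv_into_into f_inv_into_f)
  have "ends H f = \<phi> ` ends G ?e"
    using g e by (metis graph_iso_def)
  then obtain v where v: "v \<in> ends G ?e" "w = \<phi> v"
    using w by auto
  then have "?v = v"
    using p s[OF e(1)] by (auto simp: bij_betw_def intro: inv_into_f_f)
  then show "R (emark H w f) (emark G ?v ?e)"
    using m R e v unfolding marks_rel_def by metis
qed

lemma network_iso_id: "network_iso id id G G"
  by (simp add: network_iso_def graph_iso_id marks_rel_def)

lemma network_iso_trans:
  assumes "network_iso \<phi> \<psi> G H" "network_iso \<phi>' \<psi>' H K"
  shows "network_iso (\<phi>' \<circ> \<phi>) (\<psi>' \<circ> \<psi>) G K"
  using assms unfolding network_iso_def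
  by (auto intro: graph_iso_trans marks_rel_trans[where R="(=)" and S="(=)"])

lemma network_iso_sym:
  assumes "network_iso \<phi> \<psi> G H" "is_network G"
  shows "network_iso (inv_into (verts G) \<phi>) (inv_into (edges G) \<psi>) H G"
  using assms unfolding network_iso_def
  by (auto intro!: graph_iso_sym marks_rel_sym dest: network_ends_subset)

lemma rooted_iso_refl: "rooted_network x \<Longrightarrow> rooted_iso x x"
  by (cases x) (use network_iso_id in fastforce)

lemma rooted_iso_sym: "rooted_iso x y \<Longrightarrow> rooted_iso y x"
proof (cases x; cases y)
  fix G u H w assume "rooted_iso x y" "x = (G, u)" "y = (H, w)"
  then obtain \<phi> \<psi> where i: "network_iso \<phi> \<psi> G H" "\<phi> u = w"
    and *: "rooted_network (G, u)" "rooted_network (H, w)"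
    by auto
  then have "inv_into (verts G) \<phi> w = u"
    by (auto simp: network_iso_def graph_iso_def bij_betw_def)
  with network_iso_sym[OF i(1)] * have "rooted_iso (H, w) (G, u)"
    by auto
  then show ?thesis
    using \<open>x = _\<close> \<open>y = _\<close> by simp
qed

lemma rooted_iso_trans: "rooted_iso x y \<Longrightarrow> rooted_iso y z \<Longrightarrow> rooted_iso x z"
proof (cases x; cases y; cases z)
  fix G u H w K k
  assume "rooted_iso x y" "rooted_iso y z" and [simp]: "x = (G, u)" "y = (H, w)" "z = (K, k)"
  then obtain \<phi> \<psi> \<phi>' \<psi>' where "network_iso \<phi> \<psi> G H" "\<phi> u = w"
    "network_iso \<phi>' \<psi>' H K" "\<phi>' w = k"
    and *: "rooted_network (G, u)" "rooted_network (K, k)"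
    by auto
  then have "network_iso (\<phi>' \<circ> \<phi>) (\<psi>' \<circ> \<psi>) G K" "(\<phi>' \<circ> \<phi>) u = k"
    using network_iso_trans by auto
  with * show ?thesis
    by auto
qed

lemma birooted_iso_refl: "birooted_network x \<Longrightarrow> birooted_iso x x"
  by (cases x) (use network_iso_id in fastforce)

lemma birooted_iso_sym: "birooted_iso x y \<Longrightarrow> birooted_iso y x"
proof (cases x; cases y)
  fix G u v H w z assume "birooted_iso x y" "x = (G, u, v)" "y = (H, w, z)"
  then obtain \<phi> \<psi> where i: "network_iso \<phi> \<psi> G H" "\<phi> u = w" "\<phi> v = z"
    and *: "birooted_network (G, u, v)" "birooted_network (H, w, z)"
    by auto
  then have "inv_into (verts G) \<phi> w = u" "inv_into (verts G) \<phi> z = v"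
    by (auto simp: network_iso_def graph_iso_def bij_betw_def)
  with network_iso_sym[OF i(1)] * have "birooted_iso (H, w, z) (G, u, v)"
    by auto
  then show ?thesis
    using \<open>x = _\<close> \<open>y = _\<close> by simp
qed

lemma birooted_iso_trans: "birooted_iso x y \<Longrightarrow> birooted_iso y z \<Longrightarrow> birooted_iso x z"
proof (cases x; cases y; cases z)
  fix G u v H w w' K k k'
  assume "birooted_iso x y" "birooted_iso y z"
    and [simp]: "x = (G, u, v)" "y = (H, w, w')" "z = (K, k, k')"
  then obtain \<phi> \<psi> \<phi>' \<psi>' where "network_iso \<phi> \<psi> G H" "\<phi> u = w" "\<phi> v = w'"
    "network_iso \<phi>' \<psi>' H K" "\<phi>' w = k" "\<phi>' w' = k'"
    and *: "birooted_network (G, u, v)" "birooted_network (K, k, k')"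
    by auto
  then have "network_iso (\<phi>' \<circ> \<phi>) (\<psi>' \<circ> \<psi>) G K" "(\<phi>' \<circ> \<phi>) u = k" "(\<phi>' \<circ> \<phi>) v = k'"
    using network_iso_trans by auto
  with * show ?thesis
    by auto
qed

lemma is_network_point:
  "is_network \<lparr>verts = {0}, edges = {}, ends = (\<lambda>_. {}), vmark = m, emark = m'\<rparr>"
  by (auto simp: is_network_def)

text \<open>
  A connected, locally finite network is countable, so every isomorphism class has a
  representative whose vertices and edges are natural numbers; see \<open>ex_rooted_iso_nat\<close> and
  \<open>ex_birooted_iso_nat\<close> below. The space of classes can therefore be formed as a quotient of
  the networks on natural numbers.
\<close>

quotient_type 'm rooted = "(nat, nat, 'm) network \<times> nat" / partial: rooted_iso
proof (rule part_equivpI)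
  show "\<exists>x :: (nat, nat, 'm) network \<times> nat. rooted_iso x x"
    by (rule exI, rule rooted_iso_refl, subst rooted_network.simps,
        rule conjI[OF is_network_point]) simp
qed (auto intro: sympI transpI rooted_iso_sym rooted_iso_trans)

quotient_type 'm birooted = "(nat, nat, 'm) network \<times> nat \<times> nat" / partial: birooted_iso
proof (rule part_equivpI)
  show "\<exists>x :: (nat, nat, 'm) network \<times> nat \<times> nat. birooted_iso x x"
    by (rule exI, rule birooted_iso_refl, subst birooted_network.simps,
        rule conjI[OF is_network_point]) simp
qed (auto intro: sympI transpI birooted_iso_sym birooted_iso_trans)

abbreviation rclass :: "(nat, nat, 'm) network \<Rightarrow> nat \<Rightarrow> 'm rooted" where
  "rclass G u \<equiv> abs_rooted (G, u)"

abbreviation brclass :: "(nat, nat, 'm) network \<Rightarrow> nat \<Rightarrow> nat \<Rightarrow> 'm birooted" where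
  "brclass G u v \<equiv> abs_birooted (G, u, v)"

lemma rclass_eq_iff:
  assumes "rooted_network (G, u)" "rooted_network (H, w)"
  shows "rclass G u = rclass H w \<longleftrightarrow> rooted_iso (G, u) (H, w)"
  using Quotient3_rel[OF Quotient3_rooted, of "(G, u)" "(H, w)"] rooted_iso_refl[OF assms(1)]
    rooted_iso_refl[OF assms(2)] by blast

lemma brclass_eq_iff:
  assumes "birooted_network (G, u, v)" "birooted_network (H, w, z)"
  shows "brclass G u v = brclass H w z \<longleftrightarrow> birooted_iso (G, u, v) (H, w, z)"
  using Quotient3_rel[OF Quotient3_birooted, of "(G, u, v)" "(H, w, z)"]
    birooted_iso_refl[OF assms(1)] birooted_iso_refl[OF assms(2)] by blast

lemma rep_rooted: "rooted_iso (rep_rooted x) (rep_rooted x)"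
  by (rule Quotient3_rep_reflp[OF Quotient3_rooted])

lemma rep_birooted: "birooted_iso (rep_birooted x) (rep_birooted x)"
  by (rule Quotient3_rep_reflp[OF Quotient3_birooted])

lemma rooted_cases:
  obtains G u where "rooted_network (G, u)" "x = rclass G u"
  using rep_rooted[of x] Quotient3_abs_rep[OF Quotient3_rooted, of x]
  by (metis prod.exhaust rooted_iso.simps)

lemma birooted_cases:
  obtains G u v where "birooted_network (G, u, v)" "x = brclass G u v"
  using rep_birooted[of x] Quotient3_abs_rep[OF Quotient3_birooted, of x]
  by (metis prod.exhaust birooted_iso.simps)


section \<open>Balls\<close>

lemma adj_in_verts: "is_network G \<Longrightarrow> (u, v) \<in> adj G \<Longrightarrow> u \<in> verts G \<and> v \<in> verts G"
  using network_ends_subset by (fastforce simp: adj_def)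

lemma relpow_adj_in_verts:
  "is_network G \<Longrightarrow> u \<in> verts G \<Longrightarrow> (u, v) \<in> adj G ^^ n \<Longrightarrow> v \<in> verts G"
  by (induction n arbitrary: v) (auto dest: adj_in_verts)

lemma ball_verts_subset: "is_network G \<Longrightarrow> u \<in> verts G \<Longrightarrow> ball_verts G u r \<subseteq> verts G"
  by (auto simp: ball_verts_def intro: relpow_adj_in_verts)

lemma center_in_ball_verts: "u \<in> ball_verts G u r"
  by (auto simp: ball_verts_def intro!: exI[of _ 0])

lemma finite_ends: "is_network G \<Longrightarrow> e \<in> edges G \<Longrightarrow> finite (ends G e)"
  by (fastforce simp: is_network_def)

lemma finite_adj_Image: "is_network G \<Longrightarrow> v \<in> verts G \<Longrightarrow> finite (adj G `` {v})"
proof -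
  assume G: "is_network G" and v: "v \<in> verts G"
  have "finite (\<Union>e\<in>{e \<in> edges G. v \<in> ends G e}. ends G e)"
    using G v by (auto simp: is_network_def intro: finite_ends[OF G])
  then show ?thesis
    by (rule rev_finite_subset) (auto simp: adj_def)
qed

lemma finite_relpow_adj: "is_network G \<Longrightarrow> u \<in> verts G \<Longrightarrow> finite ((adj G ^^ n) `` {u})"
proof (induction n)
  case (Suc n)
  have "(adj G ^^ Suc n) `` {u} = (\<Union>v\<in>(adj G ^^ n) `` {u}. adj G `` {v})"
    by auto
  then show ?case
    using Suc by (auto intro!: finite_adj_Image intro: relpow_adj_in_verts)
qed auto

lemma finite_ball_verts: "is_network G \<Longrightarrow> u \<in> verts G \<Longrightarrow> finite (ball_verts G u r)"
proof -
  assume "is_network G" "u \<in> verts G"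
  then have "finite (\<Union>n\<le>r. (adj G ^^ n) `` {u})"
    by (auto intro: finite_relpow_adj)
  then show ?thesis
    by (rule rev_finite_subset) (auto simp: ball_verts_def)
qed

lemma finite_ball_edges:
  assumes G: "is_network G" and u: "u \<in> verts G"
  shows "finite (edges (net_ball G u r))"
proof -
  have "finite {e \<in> edges G. v \<in> ends G e}" if "v \<in> ball_verts G u r" for v
    using subsetD[OF ball_verts_subset[OF G u] that] G by (simp add: is_network_def)
  then have "finite (\<Union>v\<in>ball_verts G u r. {e \<in> edges G. v \<in> ends G e})"
    by (rule finite_UN_I[OF finite_ball_verts[OF G u]])
  moreover have "edges (net_ball G u r) \<subseteq> (\<Union>v\<in>ball_verts G u r. {e \<in> edges G. v \<in> ends G e})"
    using G by (fastforce simp: net_ball_def is_network_def)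
  ultimately show ?thesis
    by (rule rev_finite_subset)
qed

lemma ball_ends_subset: "e \<in> edges (net_ball G u r) \<Longrightarrow> ends (net_ball G u r) e \<subseteq> verts (net_ball G u r)"
  by (simp add: net_ball_def)

lemma graph_iso_adj:
  assumes "graph_iso \<phi> \<psi> G H" "(u, v) \<in> adj G"
  shows "(\<phi> u, \<phi> v) \<in> adj H"
proof -
  obtain e where "e \<in> edges G" "ends G e = {u, v}"
    using assms(2) by (auto simp: adj_def)
  then have "\<psi> e \<in> edges H" "ends H (\<psi> e) = {\<phi> u, \<phi> v}"
    using assms(1) by (auto simp: graph_iso_def dest: bij_betwE)
  then show ?thesis
    by (auto simp: adj_def)
qed

lemma graph_iso_relpow:
  "graph_iso \<phi> \<psi> G H \<Longrightarrow> (u, v) \<in> adj G ^^ n \<Longrightarrow> (\<phi> u, \<phi> v) \<in> adj H ^^ n"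
  by (induction n arbitrary: v) (auto dest: graph_iso_adj)

lemma graph_iso_ball_verts:
  assumes i: "graph_iso \<phi> \<psi> G H" and G: "is_network G" and H: "is_network H" and u: "u \<in> verts G"
  shows "\<phi> ` ball_verts G u r = ball_verts H (\<phi> u) r"
proof
  show "\<phi> ` ball_verts G u r \<subseteq> ball_verts H (\<phi> u) r"
    using graph_iso_relpow[OF i] by (auto simp: ball_verts_def)
  show "ball_verts H (\<phi> u) r \<subseteq> \<phi> ` ball_verts G u r"
  proof
    fix w assume w: "w \<in> ball_verts H (\<phi> u) r"
    let ?\<phi> = "inv_into (verts G) \<phi>"
    have b: "bij_betw \<phi> (verts G) (verts H)"
      using i by (auto simp: graph_iso_def)
    have "\<phi> u \<in> verts H"
      using b u by (auto dest: bij_betwE)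
    then have "w \<in> verts H"
      using w ball_verts_subset[OF H] by blast
    then have "\<phi> (?\<phi> w) = w"
      using b by (auto simp: bij_betw_def f_inv_into_f)
    moreover have "?\<phi> (\<phi> u) = u"
      using b u by (auto simp: bij_betw_def)
    then have "?\<phi> w \<in> ball_verts G u r"
      using w graph_iso_relpow[OF graph_iso_sym[OF i network_ends_subset[OF G]]]
      by (fastforce simp: ball_verts_def)
    ultimately show "w \<in> \<phi> ` ball_verts G u r"
      by (metis imageI)
  qed
qed

lemma network_iso_net_ball:
  assumes i: "network_iso \<phi> \<psi> G H" and G: "is_network G" and H: "is_network H" and u: "u \<in> verts G"
  shows "network_iso \<phi> \<psi> (net_ball G u r) (net_ball H (\<phi> u) r)"
proof -
  let ?B = "ball_verts G u r"
  have g: "graph_iso \<phi> \<psi> G H"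
    using i by (simp add: network_iso_def)
  have img: "ball_verts H (\<phi> u) r = \<phi> ` ?B"
    using graph_iso_ball_verts[OF g G H u] by simp
  have sub: "?B \<subseteq> verts G"
    by (rule ball_verts_subset[OF G u])
  have b: "bij_betw \<phi> (verts G) (verts H)" and c: "bij_betw \<psi> (edges G) (edges H)"
    and en: "\<And>e. e \<in> edges G \<Longrightarrow> ends H (\<psi> e) = \<phi> ` ends G e"
    using g by (auto simp: graph_iso_def)
  have inj: "inj_on \<phi> (verts G)"
    using b by (simp add: bij_betw_def)
  have eq: "ends H (\<psi> e) \<subseteq> \<phi> ` ?B \<longleftrightarrow> ends G e \<subseteq> ?B" if "e \<in> edges G" for e
    using inj_on_image_subset_iff[OF inj network_ends_subset[OF G that] sub] en[OF that] by simp
  have edges: "\<psi> ` {e \<in> edges G. ends G e \<subseteq> ?B} = {f \<in> edges H. ends H f \<subseteq> \<phi> ` ?B}"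
  proof (intro equalityI subsetI)
    fix f assume "f \<in> {f \<in> edges H. ends H f \<subseteq> \<phi> ` ?B}"
    moreover from this obtain e where "e \<in> edges G" "f = \<psi> e"
      using c by (auto simp: bij_betw_def)
    ultimately show "f \<in> \<psi> ` {e \<in> edges G. ends G e \<subseteq> ?B}"
      using eq by blast
  qed (use eq c in \<open>auto dest: bij_betwE\<close>)
  have "bij_betw \<phi> ?B (\<phi> ` ?B)"
    using inj sub by (auto simp: bij_betw_def intro: inj_on_subset)
  moreover have "bij_betw \<psi> {e \<in> edges G. ends G e \<subseteq> ?B} {f \<in> edges H. ends H f \<subseteq> \<phi> ` ?B}"
    using c edges by (auto simp: bij_betw_def intro: inj_on_subset)
  ultimately have "graph_iso \<phi> \<psi> (net_ball G u r) (net_ball H (\<phi> u) r)"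
    using en by (simp add: graph_iso_def net_ball_def img)
  moreover have "marks_rel (=) \<phi> \<psi> (net_ball G u r) (net_ball H (\<phi> u) r)"
    using i sub by (auto simp: network_iso_def marks_rel_def net_ball_def)
  ultimately show ?thesis
    by (simp add: network_iso_def)
qed


section \<open>Representatives on the natural numbers\<close>

lemma is_network_iso:
  assumes g: "graph_iso \<phi> \<psi> G H" and G: "is_network G"
  shows "is_network H"
proof -
  have inj: "inj_on \<phi> (verts G)" and V: "verts H = \<phi> ` verts G" and E: "edges H = \<psi> ` edges G"
    and en: "\<And>e. e \<in> edges G \<Longrightarrow> ends H (\<psi> e) = \<phi> ` ends G e"
    using g by (simp_all add: graph_iso_def bij_betw_def)
  have 1: "\<exists>w\<in>verts H. \<exists>z\<in>verts H. ends H (\<psi> e) = {w, z}" if e: "e \<in> edges G" for e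
  proof -
    obtain u v where "u \<in> verts G" "v \<in> verts G" "ends G e = {u, v}"
      using G e unfolding is_network_def by blast
    then show ?thesis
      unfolding en[OF e] V by simp blast
  qed
  have 2: "finite {f \<in> edges H. \<phi> v \<in> ends H f}" if v: "v \<in> verts G" for v
  proof -
    have "v \<in> ends G e" if e: "e \<in> edges G" and "\<phi> v \<in> ends H (\<psi> e)" for e
      using that inj_on_image_mem_iff[OF inj v network_ends_subset[OF G e]] en[OF e] by simp
    then have "{f \<in> edges H. \<phi> v \<in> ends H f} \<subseteq> \<psi> ` {e \<in> edges G. v \<in> ends G e}"
      unfolding E by blast
    moreover have "finite {e \<in> edges G. v \<in> ends G e}"
      using G v unfolding is_network_def by simp
    ultimately show ?thesis
      by (meson finite_imageI finite_subset)
  qed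
  have 3: "(\<phi> u, \<phi> v) \<in> (adj H)\<^sup>*" if "u \<in> verts G" "v \<in> verts G" for u v
  proof -
    have "(u, v) \<in> (adj G)\<^sup>*"
      using G that unfolding is_network_def by simp
    then obtain n where "(u, v) \<in> adj G ^^ n"
      by (auto simp: rtrancl_power)
    then show ?thesis
      using graph_iso_relpow[OF g] by (metis relpow_imp_rtrancl)
  qed
  show ?thesis
    using 1 2 3 unfolding is_network_def by (simp add: V E)
qed

lemma countable_network:
  assumes G: "is_network G" and u: "u \<in> verts G"
  shows "countable (verts G)" "countable (edges G)"
proof -
  have "verts G \<subseteq> (\<Union>n. (adj G ^^ n) `` {u})"
    using G u by (auto simp: is_network_def rtrancl_power)
  then show V: "countable (verts G)"
    by (rule countable_subset) (use finite_relpow_adj[OF G u] in \<open>auto intro: countable_finite\<close>)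
  have "edges G \<subseteq> (\<Union>v\<in>verts G. {e \<in> edges G. v \<in> ends G e})"
    using G by (fastforce simp: is_network_def)
  then show "countable (edges G)"
    by (rule countable_subset)
      (use V G in \<open>auto simp: is_network_def intro!: countable_UN intro: countable_finite\<close>)
qed

lemma ex_network_iso_nat:
  fixes G :: "('v, 'e, 'm) network"
  assumes G: "is_network G" and u: "u \<in> verts G"
  shows "\<exists>(H :: (nat, nat, 'm) network) \<phi> \<psi>. is_network H \<and> network_iso \<phi> \<psi> G H"
proof -
  let ?\<phi> = "to_nat_on (verts G)" and ?\<psi> = "to_nat_on (edges G)"
  have inj: "inj_on ?\<phi> (verts G)" "inj_on ?\<psi> (edges G)"
    using countable_network[OF G u] by auto
  let ?v = "inv_into (verts G) ?\<phi>" and ?e = "inv_into (edges G) ?\<psi>"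
  define H :: "(nat, nat, 'm) network" where
    "H = \<lparr>verts = ?\<phi> ` verts G, edges = ?\<psi> ` edges G, ends = (\<lambda>f. ?\<phi> ` ends G (?e f)),
          vmark = (\<lambda>w. vmark G (?v w)), emark = (\<lambda>w f. emark G (?v w) (?e f))\<rparr>"
  have "graph_iso ?\<phi> ?\<psi> G H"
    using inj by (auto simp: graph_iso_def H_def bij_betw_def)
  moreover have "marks_rel (=) ?\<phi> ?\<psi> G H"
    using inj network_ends_subset[OF G] by (auto simp: marks_rel_def H_def subset_iff)
  ultimately show ?thesis
    using is_network_iso G unfolding network_iso_def by blast
qed

lemma ex_rooted_iso_nat:
  fixes G :: "('v, 'e, 'm) network"
  assumes "rooted_network (G, u)"
  shows "\<exists>(H :: (nat, nat, 'm) network) w. rooted_iso (G, u) (H, w)"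
proof -
  obtain H :: "(nat, nat, 'm) network" and \<phi> \<psi> where *: "is_network H" "network_iso \<phi> \<psi> G H"
    using ex_network_iso_nat[of G u] assms by auto
  then have "\<phi> u \<in> verts H"
    using assms by (auto simp: network_iso_def graph_iso_def dest: bij_betwE)
  then have "rooted_network (H, \<phi> u)"
    using *(1) by simp
  then have "rooted_iso (G, u) (H, \<phi> u)"
    unfolding rooted_iso.simps using *(2) assms
    by (intro conjI exI[of _ \<phi>] exI[of _ \<psi>]) simp_all
  then show ?thesis
    by (rule exI[of _ H, OF exI[of _ "\<phi> u"]])
qed

lemma ex_birooted_iso_nat:
  fixes G :: "('v, 'e, 'm) network"
  assumes "birooted_network (G, u, v)"
  shows "\<exists>(H :: (nat, nat, 'm) network) w z. birooted_iso (G, u, v) (H, w, z)"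
proof -
  obtain H :: "(nat, nat, 'm) network" and \<phi> \<psi> where *: "is_network H" "network_iso \<phi> \<psi> G H"
    using ex_network_iso_nat[of G u] assms by auto
  then have "\<phi> u \<in> verts H" "\<phi> v \<in> verts H"
    using assms by (auto simp: network_iso_def graph_iso_def dest: bij_betwE)
  then have "birooted_network (H, \<phi> u, \<phi> v)"
    using *(1) by simp
  then have "birooted_iso (G, u, v) (H, \<phi> u, \<phi> v)"
    unfolding birooted_iso.simps using *(2) assms
    by (intro conjI exI[of _ \<phi>] exI[of _ \<psi>]) simp_all
  then show ?thesis
    by (rule exI[of _ H, OF exI[of _ "\<phi> u", OF exI[of _ "\<phi> v"]]])
qed


section \<open>The local topologies\<close>

text \<open>Closeness of the balls of radius \<open>r\<close> about \<open>u\<close> and \<open>w\<close>. For doubly-rooted networks it is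
  meaningful only if the second root \<open>v\<close> lies in the ball of radius \<open>r\<close> about \<open>u\<close>.\<close>

definition rooted_close ::
    "nat \<Rightarrow> real \<Rightarrow> ('v, 'e, 'm::metric_space) network \<Rightarrow> 'v \<Rightarrow> ('w, 'f, 'm) network \<Rightarrow> 'w \<Rightarrow> bool" where
  "rooted_close r \<epsilon> G u H w \<longleftrightarrow>
     (\<exists>\<phi> \<psi>. graph_iso \<phi> \<psi> (net_ball G u r) (net_ball H w r) \<and> \<phi> u = w \<and>
        marks_rel (\<lambda>x y. dist x y < \<epsilon>) \<phi> \<psi> (net_ball G u r) (net_ball H w r))"

definition birooted_close ::
    "nat \<Rightarrow> real \<Rightarrow> ('v, 'e, 'm::metric_space) network \<Rightarrow> 'v \<Rightarrow> 'v \<Rightarrow>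
     ('w, 'f, 'm) network \<Rightarrow> 'w \<Rightarrow> 'w \<Rightarrow> bool" where
  "birooted_close r \<epsilon> G u v H w z \<longleftrightarrow>
     (\<exists>\<phi> \<psi>. graph_iso \<phi> \<psi> (net_ball G u r) (net_ball H w r) \<and> \<phi> u = w \<and> \<phi> v = z \<and>
        marks_rel (\<lambda>x y. dist x y < \<epsilon>) \<phi> \<psi> (net_ball G u r) (net_ball H w r))"

definition rooted_nbhd ::
    "nat \<Rightarrow> real \<Rightarrow> (nat, nat, 'm::metric_space) network \<Rightarrow> nat \<Rightarrow> 'm rooted set" where
  "rooted_nbhd r \<epsilon> G u = {rclass H w | H w. rooted_network (H, w) \<and> rooted_close r \<epsilon> G u H w}"

definition birooted_nbhd ::
    "nat \<Rightarrow> real \<Rightarrow> (nat, nat, 'm::metric_space) network \<Rightarrow> nat \<Rightarrow> nat \<Rightarrow> 'm birooted set" where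
  "birooted_nbhd r \<epsilon> G u v =
     {brclass H w z | H w z. birooted_network (H, w, z) \<and> birooted_close r \<epsilon> G u v H w z}"

text \<open>The lemmas \<open>tendsto_rclass_iff\<close> and \<open>tendsto_brclass_iff\<close> below identify convergence in the
  topologies generated by these sets with local convergence of networks.\<close>

instantiation rooted :: (metric_space) topological_space
begin

definition open_rooted :: "'a rooted set \<Rightarrow> bool" where
  "open_rooted = generate_topology
     {rooted_nbhd r \<epsilon> G u | r \<epsilon> G u. \<epsilon> > 0 \<and> rooted_network (G, u)}"

instance
  by standard (auto simp: open_rooted_def intro: generate_topology.intros generate_topology_Union)

end

instantiation birooted :: (metric_space) topological_space
begin

definition open_birooted :: "'a birooted set \<Rightarrow> bool" where
  "open_birooted = generate_topology
     {birooted_nbhd r \<epsilon> G u v | r \<epsilon> G u v.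
        \<epsilon> > 0 \<and> birooted_network (G, u, v) \<and> v \<in> ball_verts G u r}"

instance
  by standard (auto simp: open_birooted_def intro: generate_topology.intros generate_topology_Union)

end

lemma rooted_close_refl: "\<epsilon> > 0 \<Longrightarrow> rooted_close r \<epsilon> G u G u"
  unfolding rooted_close_def by (rule exI[of _ id], rule exI[of _ id])
    (simp add: graph_iso_id marks_rel_def)

lemma birooted_close_refl: "\<epsilon> > 0 \<Longrightarrow> birooted_close r \<epsilon> G u v G u v"
  unfolding birooted_close_def by (rule exI[of _ id], rule exI[of _ id])
    (simp add: graph_iso_id marks_rel_def)

lemma rooted_close_iso:
  assumes "rooted_close r \<epsilon> G u H w" "rooted_iso (H, w) (K, k)"
  shows "rooted_close r \<epsilon> G u K k"
proof -
  obtain \<phi> \<psi> where 1: "graph_iso \<phi> \<psi> (net_ball G u r) (net_ball H w r)" "\<phi> u = w"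
    "marks_rel (\<lambda>x y. dist x y < \<epsilon>) \<phi> \<psi> (net_ball G u r) (net_ball H w r)"
    using assms(1) by (auto simp: rooted_close_def)
  obtain \<phi>' \<psi>' where 2: "network_iso \<phi>' \<psi>' H K" "\<phi>' w = k"
    and nets: "is_network H" "is_network K" "w \<in> verts H"
    using assms(2) by auto
  have 3: "network_iso \<phi>' \<psi>' (net_ball H w r) (net_ball K k r)"
    using network_iso_net_ball[OF 2(1) nets, of r] 2(2) by simp
  show ?thesis
    unfolding rooted_close_def
    by (rule exI[of _ "\<phi>' \<circ> \<phi>"], rule exI[of _ "\<psi>' \<circ> \<psi>"])
      (use 1 2 3 in \<open>auto simp: network_iso_def intro: graph_iso_trans marks_rel_trans\<close>)
qed

lemma birooted_close_iso:
  assumes "birooted_close r \<epsilon> G u v H w z" "birooted_iso (H, w, z) (K, k, l)"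
  shows "birooted_close r \<epsilon> G u v K k l"
proof -
  obtain \<phi> \<psi> where 1: "graph_iso \<phi> \<psi> (net_ball G u r) (net_ball H w r)" "\<phi> u = w" "\<phi> v = z"
    "marks_rel (\<lambda>x y. dist x y < \<epsilon>) \<phi> \<psi> (net_ball G u r) (net_ball H w r)"
    using assms(1) by (auto simp: birooted_close_def)
  obtain \<phi>' \<psi>' where 2: "network_iso \<phi>' \<psi>' H K" "\<phi>' w = k" "\<phi>' z = l"
    and nets: "is_network H" "is_network K" "w \<in> verts H"
    using assms(2) by auto
  have 3: "network_iso \<phi>' \<psi>' (net_ball H w r) (net_ball K k r)"
    using network_iso_net_ball[OF 2(1) nets, of r] 2(2) by simp
  show ?thesis
    unfolding birooted_close_def
    by (rule exI[of _ "\<phi>' \<circ> \<phi>"], rule exI[of _ "\<psi>' \<circ> \<psi>"])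
      (use 1 2 3 in \<open>auto simp: network_iso_def intro: graph_iso_trans marks_rel_trans\<close>)
qed

lemma rclass_in_nbhd_iff:
  assumes "rooted_network (H, w)"
  shows "rclass H w \<in> rooted_nbhd r \<epsilon> G u \<longleftrightarrow> rooted_close r \<epsilon> G u H w"
proof
  assume "rclass H w \<in> rooted_nbhd r \<epsilon> G u"
  then obtain K k where K: "rclass H w = rclass K k" "rooted_network (K, k)" "rooted_close r \<epsilon> G u K k"
    unfolding rooted_nbhd_def by blast
  have "rooted_iso (K, k) (H, w)"
    using K(1) rclass_eq_iff[OF assms K(2)] rooted_iso_sym by metis
  then show "rooted_close r \<epsilon> G u H w"
    by (rule rooted_close_iso[OF K(3)])
next
  assume "rooted_close r \<epsilon> G u H w"
  then show "rclass H w \<in> rooted_nbhd r \<epsilon> G u"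
    unfolding rooted_nbhd_def using assms by blast
qed

lemma brclass_in_nbhd_iff:
  assumes "birooted_network (H, w, z)"
  shows "brclass H w z \<in> birooted_nbhd r \<epsilon> G u v \<longleftrightarrow> birooted_close r \<epsilon> G u v H w z"
proof
  assume "brclass H w z \<in> birooted_nbhd r \<epsilon> G u v"
  then obtain K k l where K: "brclass H w z = brclass K k l" "birooted_network (K, k, l)"
    "birooted_close r \<epsilon> G u v K k l"
    unfolding birooted_nbhd_def by blast
  have "birooted_iso (K, k, l) (H, w, z)"
    using K(1) brclass_eq_iff[OF assms K(2)] birooted_iso_sym by metis
  then show "birooted_close r \<epsilon> G u v H w z"
    by (rule birooted_close_iso[OF K(3)])
next
  assume "birooted_close r \<epsilon> G u v H w z"
  then show "brclass H w z \<in> birooted_nbhd r \<epsilon> G u v"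
    unfolding birooted_nbhd_def using assms by blast
qed

lemma finite_less_gap:
  fixes D :: "real set"
  assumes "finite D" "\<And>x. x \<in> D \<Longrightarrow> x < \<epsilon>"
  shows "\<exists>\<delta>>0. \<forall>x\<in>D. x < \<epsilon> - \<delta>"
  using assms
proof (induction D)
  case empty
  then show ?case
    by (intro exI[of _ 1]) simp
next
  case (insert a D)
  then obtain \<delta> where \<delta>: "\<delta> > 0" "\<forall>x\<in>D. x < \<epsilon> - \<delta>"
    by auto
  have "a < \<epsilon>"
    using insert by auto
  then show ?case
    using \<delta> by (intro exI[of _ "min \<delta> ((\<epsilon> - a) / 2)"]) (auto simp: min_def field_simps)
qed

lemma marks_gap:
  fixes G :: "('v, 'e, 'm::metric_space) network" and H :: "('w, 'f, 'm) network"
  assumes fin: "finite (verts G)" "finite (edges G)" "\<And>e. e \<in> edges G \<Longrightarrow> ends G e \<subseteq> verts G"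
    and m: "marks_rel (\<lambda>x y. dist x y < \<epsilon>) \<phi> \<psi> G H"
  shows "\<exists>\<delta>>0. marks_rel (\<lambda>x y. dist x y < \<epsilon> - \<delta>) \<phi> \<psi> G H"
proof -
  let ?D = "(\<lambda>v. dist (vmark G v) (vmark H (\<phi> v))) ` verts G \<union>
    (\<lambda>(e, v). dist (emark G v e) (emark H (\<phi> v) (\<psi> e))) ` Sigma (edges G) (ends G)"
  have "finite (Sigma (edges G) (ends G))"
    using fin by (auto intro: finite_subset)
  then have "finite ?D"
    using fin(1) by blast
  moreover have "x < \<epsilon>" if "x \<in> ?D" for x
    using that m by (auto simp: marks_rel_def)
  ultimately obtain \<delta> where "\<delta> > 0" "\<forall>x\<in>?D. x < \<epsilon> - \<delta>"
    using finite_less_gap by meson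
  then show ?thesis
    by (intro exI[of _ \<delta>]) (auto simp: marks_rel_def)
qed

lemma rooted_close_gap:
  assumes "rooted_close r \<epsilon> G u H w" "rooted_network (G, u)"
  shows "\<exists>\<delta>>0. \<forall>K k. rooted_close r \<delta> H w K k \<longrightarrow> rooted_close r \<epsilon> G u K k"
proof -
  obtain \<phi> \<psi> where 1: "graph_iso \<phi> \<psi> (net_ball G u r) (net_ball H w r)" "\<phi> u = w"
    "marks_rel (\<lambda>x y. dist x y < \<epsilon>) \<phi> \<psi> (net_ball G u r) (net_ball H w r)"
    using assms(1) by (auto simp: rooted_close_def)
  have "finite (verts (net_ball G u r))" "finite (edges (net_ball G u r))"
    using assms(2) finite_ball_verts finite_ball_edges by (auto simp: net_ball_def)
  then obtain \<delta> where \<delta>: "\<delta> > 0"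
    "marks_rel (\<lambda>x y. dist x y < \<epsilon> - \<delta>) \<phi> \<psi> (net_ball G u r) (net_ball H w r)"
    using marks_gap[OF _ _ ball_ends_subset 1(3)] by blast
  have "rooted_close r \<epsilon> G u K k" if K: "rooted_close r \<delta> H w K k" for K k
  proof -
    obtain \<phi>' \<psi>' where 2: "graph_iso \<phi>' \<psi>' (net_ball H w r) (net_ball K k r)" "\<phi>' w = k"
      "marks_rel (\<lambda>x y. dist x y < \<delta>) \<phi>' \<psi>' (net_ball H w r) (net_ball K k r)"
      using K by (auto simp: rooted_close_def)
    have tri: "dist x z < \<epsilon>" if "dist x y < \<epsilon> - \<delta>" "dist y z < \<delta>" for x y z :: 'c
      using that dist_triangle[of x z y] by linarith
    show ?thesis
      unfolding rooted_close_def
      by (intro exI[of _ "\<phi>' \<circ> \<phi>"] exI[of _ "\<psi>' \<circ> \<psi>"] conjI graph_iso_trans[OF 1(1) 2(1)]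
          marks_rel_trans[OF 1(1) \<delta>(2) 2(3) tri]) (use 1 2 in auto)
  qed
  with \<delta>(1) show ?thesis
    by blast
qed

lemma birooted_close_gap:
  assumes "birooted_close r \<epsilon> G u v H w z" "birooted_network (G, u, v)"
  shows "\<exists>\<delta>>0. \<forall>K k l. birooted_close r \<delta> H w z K k l \<longrightarrow> birooted_close r \<epsilon> G u v K k l"
proof -
  obtain \<phi> \<psi> where 1: "graph_iso \<phi> \<psi> (net_ball G u r) (net_ball H w r)" "\<phi> u = w" "\<phi> v = z"
    "marks_rel (\<lambda>x y. dist x y < \<epsilon>) \<phi> \<psi> (net_ball G u r) (net_ball H w r)"
    using assms(1) by (auto simp: birooted_close_def)
  have "finite (verts (net_ball G u r))" "finite (edges (net_ball G u r))"
    using assms(2) finite_ball_verts finite_ball_edges by (auto simp: net_ball_def)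
  then obtain \<delta> where \<delta>: "\<delta> > 0"
    "marks_rel (\<lambda>x y. dist x y < \<epsilon> - \<delta>) \<phi> \<psi> (net_ball G u r) (net_ball H w r)"
    using marks_gap[OF _ _ ball_ends_subset 1(4)] by blast
  have "birooted_close r \<epsilon> G u v K k l" if K: "birooted_close r \<delta> H w z K k l" for K k l
  proof -
    obtain \<phi>' \<psi>' where 2: "graph_iso \<phi>' \<psi>' (net_ball H w r) (net_ball K k r)" "\<phi>' w = k" "\<phi>' z = l"
      "marks_rel (\<lambda>x y. dist x y < \<delta>) \<phi>' \<psi>' (net_ball H w r) (net_ball K k r)"
      using K by (auto simp: birooted_close_def)
    have tri: "dist x z < \<epsilon>" if "dist x y < \<epsilon> - \<delta>" "dist y z < \<delta>" for x y z :: 'c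
      using that dist_triangle[of x z y] by linarith
    show ?thesis
      unfolding birooted_close_def
      by (intro exI[of _ "\<phi>' \<circ> \<phi>"] exI[of _ "\<psi>' \<circ> \<psi>"] conjI graph_iso_trans[OF 1(1) 2(1)]
          marks_rel_trans[OF 1(1) \<delta>(2) 2(4) tri]) (use 1 2 in auto)
  qed
  with \<delta>(1) show ?thesis
    by blast
qed

lemma birooted_close_in_ball:
  assumes "birooted_close r \<epsilon> G u v H w z" "v \<in> ball_verts G u r"
  shows "z \<in> ball_verts H w r"
  using assms by (auto simp: birooted_close_def graph_iso_def net_ball_def dest: bij_betwE)

lemma tendsto_rclass_iff:
  fixes G :: "(nat, nat, 'm::metric_space) network"
  assumes G: "rooted_network (G, u)" and Gs: "\<And>n. rooted_network (Gs n, us n)"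
  shows "((\<lambda>n. rclass (Gs n) (us n)) \<longlongrightarrow> rclass G u) F \<longleftrightarrow>
    (\<forall>r. \<forall>\<epsilon>>0. \<forall>\<^sub>F n in F. rooted_close r \<epsilon> G u (Gs n) (us n))"
proof (intro iffI allI impI)
  fix r and \<epsilon> :: real
  assume lim: "((\<lambda>n. rclass (Gs n) (us n)) \<longlongrightarrow> rclass G u) F" and \<epsilon>: "\<epsilon> > 0"
  have "open (rooted_nbhd r \<epsilon> G u)"
    unfolding open_rooted_def using G \<epsilon> by (intro generate_topology.Basis) blast
  moreover have "rclass G u \<in> rooted_nbhd r \<epsilon> G u"
    unfolding rclass_in_nbhd_iff[OF G] using \<epsilon> by (rule rooted_close_refl)
  ultimately have "\<forall>\<^sub>F n in F. rclass (Gs n) (us n) \<in> rooted_nbhd r \<epsilon> G u"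
    by (rule topological_tendstoD[OF lim])
  then show "\<forall>\<^sub>F n in F. rooted_close r \<epsilon> G u (Gs n) (us n)"
    unfolding rclass_in_nbhd_iff[OF Gs] .
next
  assume *: "\<forall>r. \<forall>\<epsilon>>0. \<forall>\<^sub>F n in F. rooted_close r \<epsilon> G u (Gs n) (us n)"
  show "((\<lambda>n. rclass (Gs n) (us n)) \<longlongrightarrow> rclass G u) F"
  proof (rule topological_tendstoI)
    fix S :: "'m rooted set" assume "open S" "rclass G u \<in> S"
    then show "\<forall>\<^sub>F n in F. rclass (Gs n) (us n) \<in> S"
      unfolding open_rooted_def
    proof (induction S rule: generate_topology.induct)
      case (UN K)
      then obtain k where "k \<in> K" "\<forall>\<^sub>F n in F. rclass (Gs n) (us n) \<in> k"
        by blast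
      then show ?case
        by (auto elim: eventually_mono)
    next
      case (Basis S)
      then obtain r \<epsilon> H w where S: "S = rooted_nbhd r \<epsilon> H w" and H: "rooted_network (H, w)"
        by blast
      then have c: "rooted_close r \<epsilon> H w G u"
        using Basis rclass_in_nbhd_iff[OF G] by blast
      have "\<exists>\<delta>>0. \<forall>(K :: (nat, nat, 'm) network) k.
          rooted_close r \<delta> G u K k \<longrightarrow> rooted_close r \<epsilon> H w K k"
        by (rule rooted_close_gap[OF c H])
      then obtain \<delta> where "\<delta> > 0" and imp: "\<forall>(K :: (nat, nat, 'm) network) k.
          rooted_close r \<delta> G u K k \<longrightarrow> rooted_close r \<epsilon> H w K k"
        by (elim exE conjE)
      then have "\<forall>\<^sub>F n in F. rooted_close r \<delta> G u (Gs n) (us n)"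
        using * by simp
      then show ?case
        unfolding S rclass_in_nbhd_iff[OF Gs] by (rule eventually_mono) (simp add: imp)
    qed (auto simp: eventually_conj_iff)
  qed
qed

lemma tendsto_brclass_iff:
  fixes G :: "(nat, nat, 'm::metric_space) network"
  assumes G: "birooted_network (G, u, v)" and Gs: "\<And>n. birooted_network (Gs n, us n, vs n)"
  shows "((\<lambda>n. brclass (Gs n) (us n) (vs n)) \<longlongrightarrow> brclass G u v) F \<longleftrightarrow>
    (\<forall>r. v \<in> ball_verts G u r \<longrightarrow>
       (\<forall>\<epsilon>>0. \<forall>\<^sub>F n in F. birooted_close r \<epsilon> G u v (Gs n) (us n) (vs n)))"
proof (intro iffI allI impI)
  fix r and \<epsilon> :: real
  assume lim: "((\<lambda>n. brclass (Gs n) (us n) (vs n)) \<longlongrightarrow> brclass G u v) F"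
    and v: "v \<in> ball_verts G u r" and \<epsilon>: "\<epsilon> > 0"
  have "open (birooted_nbhd r \<epsilon> G u v)"
    unfolding open_birooted_def using G v \<epsilon> by (intro generate_topology.Basis) blast
  moreover have "brclass G u v \<in> birooted_nbhd r \<epsilon> G u v"
    unfolding brclass_in_nbhd_iff[OF G] using \<epsilon> by (rule birooted_close_refl)
  ultimately have "\<forall>\<^sub>F n in F. brclass (Gs n) (us n) (vs n) \<in> birooted_nbhd r \<epsilon> G u v"
    by (rule topological_tendstoD[OF lim])
  then show "\<forall>\<^sub>F n in F. birooted_close r \<epsilon> G u v (Gs n) (us n) (vs n)"
    unfolding brclass_in_nbhd_iff[OF Gs] .
next
  assume *: "\<forall>r. v \<in> ball_verts G u r \<longrightarrow>
    (\<forall>\<epsilon>>0. \<forall>\<^sub>F n in F. birooted_close r \<epsilon> G u v (Gs n) (us n) (vs n))"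
  show "((\<lambda>n. brclass (Gs n) (us n) (vs n)) \<longlongrightarrow> brclass G u v) F"
  proof (rule topological_tendstoI)
    fix S :: "'m birooted set" assume "open S" "brclass G u v \<in> S"
    then show "\<forall>\<^sub>F n in F. brclass (Gs n) (us n) (vs n) \<in> S"
      unfolding open_birooted_def
    proof (induction S rule: generate_topology.induct)
      case (UN K)
      then obtain k where "k \<in> K" "\<forall>\<^sub>F n in F. brclass (Gs n) (us n) (vs n) \<in> k"
        by blast
      then show ?case
        by (auto elim: eventually_mono)
    next
      case (Basis S)
      then obtain r \<epsilon> H w z where S: "S = birooted_nbhd r \<epsilon> H w z"
        and H: "birooted_network (H, w, z)" "z \<in> ball_verts H w r"
        by blast
      then have c: "birooted_close r \<epsilon> H w z G u v"
        using Basis brclass_in_nbhd_iff[OF G] by blast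
      have "\<exists>\<delta>>0. \<forall>(K :: (nat, nat, 'm) network) k l.
          birooted_close r \<delta> G u v K k l \<longrightarrow> birooted_close r \<epsilon> H w z K k l"
        by (rule birooted_close_gap[OF c H(1)])
      then obtain \<delta> where "\<delta> > 0" and imp: "\<forall>(K :: (nat, nat, 'm) network) k l.
          birooted_close r \<delta> G u v K k l \<longrightarrow> birooted_close r \<epsilon> H w z K k l"
        by (elim exE conjE)
      moreover have "v \<in> ball_verts G u r"
        using birooted_close_in_ball[OF c H(2)] .
      ultimately have "\<forall>\<^sub>F n in F. birooted_close r \<delta> G u v (Gs n) (us n) (vs n)"
        using * by simp
      then show ?case
        unfolding S brclass_in_nbhd_iff[OF Gs] by (rule eventually_mono) (simp add: imp)
    qed (auto simp: eventually_conj_iff)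
  qed
qed


section \<open>Transport kernels, unimodularity and the invariant sigma-field\<close>

text \<open>Sums of nonnegative terms over the vertices, possibly infinite, are integrals with respect
  to the counting measure.\<close>

definition mass_out :: "('m birooted \<Rightarrow> real) \<Rightarrow> (nat, nat, 'm) network \<Rightarrow> nat \<Rightarrow> ennreal" where
  "mass_out T G u = (\<integral>\<^sup>+v. ennreal (T (brclass G u v)) \<partial>count_space (verts G))"

definition mass_in :: "('m birooted \<Rightarrow> real) \<Rightarrow> (nat, nat, 'm) network \<Rightarrow> nat \<Rightarrow> ennreal" where
  "mass_in T G u = (\<integral>\<^sup>+v. ennreal (T (brclass G v u)) \<partial>count_space (verts G))"

definition root_mass_out :: "('m birooted \<Rightarrow> real) \<Rightarrow> 'm rooted \<Rightarrow> ennreal" where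
  "root_mass_out T x = (case rep_rooted x of (G, u) \<Rightarrow> mass_out T G u)"

definition root_mass_in :: "('m birooted \<Rightarrow> real) \<Rightarrow> 'm rooted \<Rightarrow> ennreal" where
  "root_mass_in T x = (case rep_rooted x of (G, u) \<Rightarrow> mass_in T G u)"

lemma mass_out_in_cong:
  assumes "rooted_iso (G, u) (H, w)"
  shows "mass_out T G u = mass_out T H w" "mass_in T G u = mass_in T H w"
proof -
  obtain \<phi> \<psi> where i: "network_iso \<phi> \<psi> G H" "\<phi> u = w"
    and n: "is_network G" "is_network H" "u \<in> verts G" "w \<in> verts H"
    using assms by auto
  then have b: "bij_betw \<phi> (verts G) (verts H)"
    by (auto simp: network_iso_def graph_iso_def)
  have eq: "brclass G x y = brclass H (\<phi> x) (\<phi> y)" if "x \<in> verts G" "y \<in> verts G" for x y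
  proof -
    have "\<phi> x \<in> verts H" "\<phi> y \<in> verts H"
      using b that by (auto dest: bij_betwE)
    then show ?thesis
      using i(1) n that by (subst brclass_eq_iff) auto
  qed
  show "mass_out T G u = mass_out T H w"
    unfolding mass_out_def nn_integral_bij_count_space[OF b, symmetric]
    using eq i n by (intro nn_integral_cong) simp
  show "mass_in T G u = mass_in T H w"
    unfolding mass_in_def nn_integral_bij_count_space[OF b, symmetric]
    using eq i n by (intro nn_integral_cong) simp
qed

lemma root_mass_rclass:
  assumes "rooted_network (G, u)"
  shows "root_mass_out T (rclass G u) = mass_out T G u"
    and "root_mass_in T (rclass G u) = mass_in T G u"
proof -
  obtain H w where r: "rep_rooted (rclass G u) = (H, w)"
    by fastforce
  have "rooted_iso (H, w) (G, u)"
    using Quotient3_rep_abs[OF Quotient3_rooted rooted_iso_refl[OF assms]] r by simp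
  then show "root_mass_out T (rclass G u) = mass_out T G u"
    and "root_mass_in T (rclass G u) = mass_in T G u"
    using mass_out_in_cong[OF \<open>rooted_iso (H, w) (G, u)\<close>]
    by (simp_all add: root_mass_out_def root_mass_in_def r)
qed

definition unimodular :: "'a measure \<Rightarrow> ('a \<Rightarrow> 'm::metric_space rooted) \<Rightarrow> bool" where
  "unimodular M X \<longleftrightarrow>
     (\<forall>g :: 'm birooted \<Rightarrow> real. g \<in> borel_measurable borel \<longrightarrow> (\<forall>x. 0 \<le> g x) \<longrightarrow>
        (\<integral>\<^sup>+\<omega>. root_mass_out g (X \<omega>) \<partial>M) = (\<integral>\<^sup>+\<omega>. root_mass_in g (X \<omega>) \<partial>M))"

definition invariant_sets :: "'m::metric_space rooted set set" where
  "invariant_sets =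
     {A \<in> sets borel. \<forall>G u v. rooted_network (G, u) \<longrightarrow> v \<in> verts G \<longrightarrow>
        rclass G u \<in> A \<longrightarrow> rclass G v \<in> A}"

definition invariant_algebra :: "'a measure \<Rightarrow> ('a \<Rightarrow> 'm::metric_space rooted) \<Rightarrow> 'a measure" where
  "invariant_algebra M X = vimage_algebra (space M) X (sigma UNIV invariant_sets)"

lemma sigma_algebra_invariant_sets: "sigma_algebra UNIV invariant_sets"
proof (rule sigma_algebra_iff2[THEN iffD2], intro conjI ballI allI impI)
  fix A :: "'a rooted set" assume A: "A \<in> invariant_sets"
  have "rclass G v \<notin> A" if "rooted_network (G, u)" "v \<in> verts G" "rclass G u \<notin> A" for G u v
  proof
    assume "rclass G v \<in> A"
    moreover have "rooted_network (G, v)" "u \<in> verts G"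
      using that by auto
    moreover have "\<forall>G u v. rooted_network (G, u) \<longrightarrow> v \<in> verts G \<longrightarrow>
        rclass G u \<in> A \<longrightarrow> rclass G v \<in> A"
      using A unfolding invariant_sets_def mem_Collect_eq by (rule conjunct2)
    ultimately show False
      using that(3) by blast
  qed
  moreover have "UNIV - A \<in> sets borel"
    using A unfolding invariant_sets_def by auto
  ultimately show "UNIV - A \<in> invariant_sets"
    unfolding invariant_sets_def by blast
next
  fix A :: "nat \<Rightarrow> 'a rooted set" assume "range A \<subseteq> invariant_sets"
  then have A: "A i \<in> invariant_sets" for i
    by auto
  then have "(\<Union>i. A i) \<in> sets borel"
    unfolding invariant_sets_def by (intro sets.countable_UN) auto
  then show "(\<Union>i. A i) \<in> invariant_sets"
    using A unfolding invariant_sets_def by blast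
qed (auto simp: invariant_sets_def)

lemma sets_invariant_algebra:
  "sets (invariant_algebra M X) = {X -` A \<inter> space M | A. A \<in> invariant_sets}"
  unfolding invariant_algebra_def
  by (subst sets_vimage_algebra2)
    (auto simp: sigma_algebra.sets_measure_of_eq[OF sigma_algebra_invariant_sets])

lemma subalgebra_invariant_algebra:
  "X \<in> M \<rightarrow>\<^sub>M borel \<Longrightarrow> subalgebra M (invariant_algebra M X)"
  unfolding subalgebra_def sets_invariant_algebra
  by (auto simp: invariant_algebra_def invariant_sets_def)

definition balances ::
    "('m birooted \<Rightarrow> real) \<Rightarrow> (nat, nat, 'm) network \<Rightarrow> (nat \<Rightarrow> real) \<Rightarrow> (nat \<Rightarrow> real) \<Rightarrow> bool" where
  "balances T G f g \<longleftrightarrow>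
     (\<forall>v\<in>verts G. mass_out T G v = ennreal (f v) \<and> mass_in T G v = ennreal (g v))"

text \<open>Almost surely, \<open>T\<close> balances between \<open>w1\<close> and \<open>w2\<close> on the random network \<open>X\<close>. The condition
  does not depend on the representative \<open>(G, u)\<close> of \<open>X \<omega>\<close>.\<close>

definition as_balances ::
    "'a measure \<Rightarrow> ('a \<Rightarrow> 'm rooted) \<Rightarrow> ('m birooted \<Rightarrow> real) \<Rightarrow>
     ('m rooted \<Rightarrow> real) \<Rightarrow> ('m rooted \<Rightarrow> real) \<Rightarrow> bool" where
  "as_balances M X T w1 w2 \<longleftrightarrow>
     (AE \<omega> in M. \<forall>G u. rooted_network (G, u) \<longrightarrow> X \<omega> = rclass G u \<longrightarrow>
        balances T G (\<lambda>v. w1 (rclass G v)) (\<lambda>v. w2 (rclass G v)))"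

end

theory Submission
  imports Defs
begin

text \<open>
  Suppose first that a kernel \<open>T\<close> balances \<open>w\<^sub>1\<close> and \<open>w\<^sub>2\<close>. For an invariant set \<open>A\<close>, the mass transport
  principle applied to \<open>1\<^sub>A[G, u] T[G, u, v]\<close> gives \<open>E[w\<^sub>1; A] = E[w\<^sub>2; A]\<close>, which is equality of the
  conditional expectations.

  Conversely, a kernel is built by a greedy procedure. In a round of radius \<open>r\<close>, with supplies \<open>a\<close> and
  demands \<open>b\<close> left over so far, the amount \<open>a(u) b(v) / max (S\<^sub>r b(u)) (S\<^sub>r a(v))\<close> moves from \<open>u\<close> to each
  \<open>v\<close> within distance \<open>r\<close>, where \<open>S\<^sub>r\<close> sums over the ball of radius \<open>r\<close>. No vertex sends more than it has
  or receives more than it wants. If every radius recurs infinitely often, then in the limit a network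
  cannot contain both a vertex with supply left and a vertex with demand left, because a fixed positive
  amount would have moved between the two infinitely often (\<open>maximal_transport\<close>). So on each network
  all supplies are used up or all demands are met, and which of the two happens is decided by an
  invariant set. On invariant sets with \<open>E[w\<^sub>1; A] = E[w\<^sub>2; A] < \<infinity>\<close> the mass transport principle then forces
  the leftovers of both kinds to vanish at the root almost surely, and hence at every vertex
  (\<open>balancing_of_equal_integrals\<close>, \<open>AE_root_imp_AE_all_vertices\<close>). The sublevel sets of the
  almost surely finite conditional expectation of \<open>w\<^sub>1\<close> are such invariant sets and exhaust the space.

  The procedure must be measurable. All its ingredients come from the two root projections and from
  summation over the second root. The projections are continuous (\<open>continuous_src\<close>, \<open>continuous_swap\<close>).
  Summation preserves measurability (\<open>measurable_out_sum\<close>): for the indicator of an open set, restricted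
  to a ball, it is a lower semicontinuous count, since isomorphisms between nearby balls carry the counted
  vertices along.
\<close>

section \<open>Isomorphisms between balls\<close>

lemma adj_sym: "(u, v) \<in> adj G \<Longrightarrow> (v, u) \<in> adj G"
  by (auto simp: adj_def insert_commute)

lemma relpow_adj_sym: "(u, v) \<in> adj G ^^ n \<Longrightarrow> (v, u) \<in> adj G ^^ n"
proof (induction n arbitrary: v)
  case (Suc n)
  then obtain w where "(u, w) \<in> adj G ^^ n" "(w, v) \<in> adj G"
    by auto
  then show ?case
    using Suc.IH adj_sym relpow_Suc_I2 by metis
qed simp

lemma ball_verts_sym: "v \<in> ball_verts G u r \<longleftrightarrow> u \<in> ball_verts G v r"
  by (auto simp: ball_verts_def dest: relpow_adj_sym)

lemma ball_verts_mono: "v \<in> ball_verts G u r \<Longrightarrow> r \<le> R \<Longrightarrow> v \<in> ball_verts G u R"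
  by (auto simp: ball_verts_def dest: order_trans)

lemma ball_verts_trans:
  assumes "v \<in> ball_verts G u d" "w \<in> ball_verts G v r" "d + r \<le> R"
  shows "w \<in> ball_verts G u R"
proof -
  obtain m n where m: "m \<le> d" "(u, v) \<in> adj G ^^ m" and n: "n \<le> r" "(v, w) \<in> adj G ^^ n"
    using assms(1,2) by (auto simp: ball_verts_def)
  then have "(u, w) \<in> adj G ^^ (m + n)"
    by (auto simp: relpow_add)
  moreover have "m + n \<le> R"
    using m n assms(3) by simp
  ultimately show ?thesis
    by (auto simp: ball_verts_def)
qed

lemma adj_net_ball:
  "adj (net_ball G u R) = adj G \<inter> (ball_verts G u R \<times> ball_verts G u R)"
  by (auto simp: adj_def net_ball_def)

text \<open>A path of length \<open>n\<close> that starts at distance at most \<open>d\<close> from the centre \<open>u\<close> never leaves the ball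
  of radius \<open>d + n\<close>. So a large ball computes distances correctly near its centre, and the smaller
  balls inside it are intrinsic to it.\<close>

lemma relpow_net_ball:
  assumes v: "v \<in> ball_verts G u d" and w: "(v, w) \<in> adj G ^^ n" and le: "d + n \<le> R"
  shows "(v, w) \<in> adj (net_ball G u R) ^^ n"
  using w le
proof (induction n arbitrary: w)
  case (Suc n)
  then obtain x where x: "(v, x) \<in> adj G ^^ n" "(x, w) \<in> adj G"
    by auto
  then have "(v, x) \<in> adj (net_ball G u R) ^^ n"
    using Suc by simp
  moreover have "x \<in> ball_verts G u R" "w \<in> ball_verts G u R"
    using Suc.prems x(1) ball_verts_trans[OF v, of x n R] ball_verts_trans[OF v, of w "Suc n" R]
    by (auto simp: ball_verts_def simp del: relpow.simps)
  ultimately show ?case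
    using x(2) by (auto simp: adj_net_ball)
qed simp

lemma ball_verts_net_ball:
  assumes v: "v \<in> ball_verts G u d" and le: "d + r \<le> R"
  shows "ball_verts (net_ball G u R) v r = ball_verts G v r"
proof
  have "(adj (net_ball G u R)) ^^ n \<subseteq> adj G ^^ n" for n
    by (induction n) (auto simp: adj_net_ball)
  then show "ball_verts (net_ball G u R) v r \<subseteq> ball_verts G v r"
    by (auto simp: ball_verts_def)
  show "ball_verts G v r \<subseteq> ball_verts (net_ball G u R) v r"
  proof
    fix w assume "w \<in> ball_verts G v r"
    then obtain n where "n \<le> r" "(v, w) \<in> adj G ^^ n"
      unfolding ball_verts_def by blast
    then show "w \<in> ball_verts (net_ball G u R) v r"
      using relpow_net_ball[OF v, of w n R] le unfolding ball_verts_def by auto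
  qed
qed

lemma net_ball_net_ball:
  assumes v: "v \<in> ball_verts G u d" and le: "d + r \<le> R"
  shows "net_ball (net_ball G u R) v r = net_ball G v r"
proof -
  have "ball_verts G v r \<subseteq> ball_verts G u R"
    using ball_verts_trans[OF v _ le] by blast
  then have "{e \<in> edges G. ends G e \<subseteq> ball_verts G u R \<and> ends G e \<subseteq> ball_verts G v r}
    = {e \<in> edges G. ends G e \<subseteq> ball_verts G v r}"
    by blast
  then show ?thesis
    using ball_verts_net_ball[OF assms] by (simp add: net_ball_def)
qed

lemma is_network_net_ball:
  assumes G: "is_network G" and u: "u \<in> verts G"
  shows "is_network (net_ball G u R)"
proof -
  let ?N = "net_ball G u R"
  have "\<exists>x\<in>verts ?N. \<exists>y\<in>verts ?N. ends ?N e = {x, y}" if e: "e \<in> edges ?N" for e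
    using e G unfolding is_network_def net_ball_def by fastforce
  moreover have "finite {e \<in> edges ?N. v \<in> ends ?N e}" for v
    using finite_ball_edges[OF G u, of R] by simp
  moreover have "(u, v) \<in> (adj ?N)\<^sup>*" if v: "v \<in> verts ?N" for v
  proof -
    obtain n where "n \<le> R" "(u, v) \<in> adj G ^^ n"
      using v by (auto simp: net_ball_def ball_verts_def)
    then show ?thesis
      using relpow_net_ball[of u G u 0 v n R, OF center_in_ball_verts]
      by (auto dest: relpow_imp_rtrancl)
  qed
  moreover have "sym (adj ?N)"
    by (auto intro: symI adj_sym)
  ultimately show ?thesis
    unfolding is_network_def by (meson rtrancl_trans sym_rtrancl symD)
qed

text \<open>Erasing the marks makes every graph isomorphism an isomorphism of networks, and those
  are known to restrict to balls.\<close>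

lemma graph_iso_net_ball:
  assumes g: "graph_iso \<phi> \<psi> G H" and G: "is_network G" and H: "is_network H" and u: "u \<in> verts G"
  shows "graph_iso \<phi> \<psi> (net_ball G u r) (net_ball H (\<phi> u) r)"
proof -
  let ?G = "G\<lparr>vmark := \<lambda>_. undefined, emark := \<lambda>_ _. undefined\<rparr>"
  let ?H = "H\<lparr>vmark := \<lambda>_. undefined, emark := \<lambda>_ _. undefined\<rparr>"
  have "network_iso \<phi> \<psi> ?G ?H"
    using g by (simp add: network_iso_def graph_iso_def marks_rel_def)
  moreover have adj: "adj ?G = adj G" "adj ?H = adj H"
    by (simp_all add: adj_def)
  ultimately have "network_iso \<phi> \<psi> (net_ball ?G u r) (net_ball ?H (\<phi> u) r)"
    using G H u by (intro network_iso_net_ball) (simp_all add: is_network_def)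
  moreover have "net_ball ?G u r = net_ball G u r\<lparr>vmark := \<lambda>_. undefined, emark := \<lambda>_ _. undefined\<rparr>"
      "net_ball ?H (\<phi> u) r = net_ball H (\<phi> u) r\<lparr>vmark := \<lambda>_. undefined, emark := \<lambda>_ _. undefined\<rparr>"
    by (simp_all add: net_ball_def ball_verts_def adj)
  ultimately show ?thesis
    by (simp add: network_iso_def graph_iso_def)
qed

text \<open>Closeness of balls with the witnessing isomorphism made explicit: one isomorphism has to serve for
  several choices of the second root at once.\<close>

definition ball_match ::
    "nat \<Rightarrow> real \<Rightarrow> ('v \<Rightarrow> 'w) \<Rightarrow> ('e \<Rightarrow> 'f) \<Rightarrow>
     ('v, 'e, 'm::metric_space) network \<Rightarrow> 'v \<Rightarrow> ('w, 'f, 'm) network \<Rightarrow> 'w \<Rightarrow> bool" where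
  "ball_match r \<epsilon> \<phi> \<psi> G u H w \<longleftrightarrow>
     graph_iso \<phi> \<psi> (net_ball G u r) (net_ball H w r) \<and> \<phi> u = w \<and>
     marks_rel (\<lambda>x y. dist x y < \<epsilon>) \<phi> \<psi> (net_ball G u r) (net_ball H w r)"

lemma rooted_close_iff: "rooted_close r \<epsilon> G u H w \<longleftrightarrow> (\<exists>\<phi> \<psi>. ball_match r \<epsilon> \<phi> \<psi> G u H w)"
  by (simp add: rooted_close_def ball_match_def)

lemma birooted_close_iff:
  "birooted_close r \<epsilon> G u v H w z \<longleftrightarrow> (\<exists>\<phi> \<psi>. ball_match r \<epsilon> \<phi> \<psi> G u H w \<and> \<phi> v = z)"
  by (auto simp: birooted_close_def ball_match_def)

lemma ball_match_image:
  assumes m: "ball_match R \<epsilon> \<phi> \<psi> G u H w" and G: "rooted_network (G, u)" and H: "rooted_network (H, w)"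
    and v: "v \<in> ball_verts G u d" and le: "d + r \<le> R"
  shows "\<phi> ` ball_verts G v r = ball_verts H (\<phi> v) r" "\<phi> v \<in> ball_verts H w d"
proof -
  have g: "graph_iso \<phi> \<psi> (net_ball G u R) (net_ball H w R)" and w: "\<phi> u = w"
    using m by (auto simp: ball_match_def)
  have nG: "is_network (net_ball G u R)" and nH: "is_network (net_ball H w R)"
    using G H by (auto intro: is_network_net_ball)
  have *: "\<phi> ` ball_verts (net_ball G u R) x s = ball_verts (net_ball H w R) (\<phi> x) s"
    if "x \<in> ball_verts G u R" for x s
    using that by (intro graph_iso_ball_verts[OF g nG nH]) (simp add: net_ball_def)
  have "\<phi> ` ball_verts G u d = ball_verts H w d"
    using *[OF center_in_ball_verts, of d] le
      ball_verts_net_ball[OF center_in_ball_verts, of 0 d R G u]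
      ball_verts_net_ball[OF center_in_ball_verts, of 0 d R H w] by (simp add: w)
  then show v': "\<phi> v \<in> ball_verts H w d"
    using v by blast
  have "v \<in> ball_verts G u R"
    using v le by (auto intro: ball_verts_mono)
  then show "\<phi> ` ball_verts G v r = ball_verts H (\<phi> v) r"
    using * ball_verts_net_ball[OF v le] ball_verts_net_ball[OF v' le] by metis
qed

text \<open>An approximate isomorphism of large balls about \<open>u\<close> and \<open>w\<close> is also one of smaller balls about
  any matched pair of nearby vertices. This is what makes exchanging the two roots continuous.\<close>

lemma ball_match_shift:
  assumes m: "ball_match R \<epsilon> \<phi> \<psi> G u H w" and G: "rooted_network (G, u)" and H: "rooted_network (H, w)"
    and v: "v \<in> ball_verts G u d" and le: "d + r \<le> R" and e: "\<epsilon> \<le> \<epsilon>'"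
  shows "ball_match r \<epsilon>' \<phi> \<psi> G v H (\<phi> v)"
proof -
  have g: "graph_iso \<phi> \<psi> (net_ball G u R) (net_ball H w R)"
    and mr: "marks_rel (\<lambda>x y. dist x y < \<epsilon>) \<phi> \<psi> (net_ball G u R) (net_ball H w R)"
    using m by (auto simp: ball_match_def)
  have nG: "is_network (net_ball G u R)" and nH: "is_network (net_ball H w R)"
    using G H by (auto intro: is_network_net_ball)
  have v': "\<phi> v \<in> ball_verts H w d"
    by (rule ball_match_image[OF m G H v le])
  have "v \<in> ball_verts G u R"
    using v le by (auto intro: ball_verts_mono)
  then have "graph_iso \<phi> \<psi> (net_ball (net_ball G u R) v r) (net_ball (net_ball H w R) (\<phi> v) r)"
    by (intro graph_iso_net_ball[OF g nG nH]) (simp add: net_ball_def)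
  then have "graph_iso \<phi> \<psi> (net_ball G v r) (net_ball H (\<phi> v) r)"
    by (simp add: net_ball_net_ball[OF v le] net_ball_net_ball[OF v' le])
  moreover have "ball_verts G v r \<subseteq> ball_verts G u R"
    using ball_verts_trans[OF v _ le] by blast
  then have "marks_rel (\<lambda>x y. dist x y < \<epsilon>') \<phi> \<psi> (net_ball G v r) (net_ball H (\<phi> v) r)"
    using mr e unfolding marks_rel_def net_ball_def by fastforce
  ultimately show ?thesis
    by (simp add: ball_match_def)
qed

lemma ball_match_mono:
  assumes "ball_match R \<epsilon> \<phi> \<psi> G u H w" "rooted_network (G, u)" "rooted_network (H, w)"
    "r \<le> R" "\<epsilon> \<le> \<epsilon>'"
  shows "ball_match r \<epsilon>' \<phi> \<psi> G u H w"
proof -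
  have "\<phi> u = w"
    using assms(1) by (simp add: ball_match_def)
  then show ?thesis
    using ball_match_shift[OF assms(1-3) center_in_ball_verts, of 0 r] assms(4,5) by simp
qed

section \<open>Neighbourhood criteria for the local topologies\<close>

lemma open_birootedI:
  fixes S :: "'m::metric_space birooted set"
  assumes "\<And>G u v. birooted_network (G, u, v) \<Longrightarrow> brclass G u v \<in> S \<Longrightarrow>
    \<exists>R \<epsilon>. \<epsilon> > 0 \<and> v \<in> ball_verts G u R \<and> (\<forall>H w z. birooted_network (H, w, z) \<longrightarrow>
      birooted_close R \<epsilon> G u v H w z \<longrightarrow> brclass H w z \<in> S)"
  shows "open S"
proof (subst open_subopen, rule ballI)
  fix x assume "x \<in> S"
  moreover obtain G u v where G: "birooted_network (G, u, v)" and x: "x = brclass G u v"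
    by (rule birooted_cases)
  ultimately obtain R \<epsilon> where R: "\<epsilon> > 0" "v \<in> ball_verts G u R"
    "\<forall>H w z. birooted_network (H, w, z) \<longrightarrow> birooted_close R \<epsilon> G u v H w z \<longrightarrow> brclass H w z \<in> S"
    using assms by blast
  have "open (birooted_nbhd R \<epsilon> G u v)"
    unfolding open_birooted_def using R G by (intro generate_topology.Basis) blast
  moreover have "x \<in> birooted_nbhd R \<epsilon> G u v"
    unfolding x brclass_in_nbhd_iff[OF G] by (rule birooted_close_refl[OF R(1)])
  moreover have "birooted_nbhd R \<epsilon> G u v \<subseteq> S"
    using R(3) unfolding birooted_nbhd_def by blast
  ultimately show "\<exists>T. open T \<and> x \<in> T \<and> T \<subseteq> S"
    by blast
qed

lemma open_rootedI:
  fixes S :: "'m::metric_space rooted set"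
  assumes "\<And>G u. rooted_network (G, u) \<Longrightarrow> rclass G u \<in> S \<Longrightarrow>
    \<exists>R \<epsilon>. \<epsilon> > 0 \<and> (\<forall>H w. rooted_network (H, w) \<longrightarrow>
      rooted_close R \<epsilon> G u H w \<longrightarrow> rclass H w \<in> S)"
  shows "open S"
proof (subst open_subopen, rule ballI)
  fix x assume "x \<in> S"
  moreover obtain G u where G: "rooted_network (G, u)" and x: "x = rclass G u"
    by (rule rooted_cases)
  ultimately obtain R \<epsilon> where R: "\<epsilon> > 0"
    "\<forall>H w. rooted_network (H, w) \<longrightarrow> rooted_close R \<epsilon> G u H w \<longrightarrow> rclass H w \<in> S"
    using assms by blast
  have "open (rooted_nbhd R \<epsilon> G u)"
    unfolding open_rooted_def using R G by (intro generate_topology.Basis) blast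
  moreover have "x \<in> rooted_nbhd R \<epsilon> G u"
    unfolding x rclass_in_nbhd_iff[OF G] by (rule rooted_close_refl[OF R(1)])
  moreover have "rooted_nbhd R \<epsilon> G u \<subseteq> S"
    using R(2) unfolding rooted_nbhd_def by blast
  ultimately show "\<exists>T. open T \<and> x \<in> T \<and> T \<subseteq> S"
    by blast
qed

text \<open>Counterexamples for infinitely many radii \<open>n\<close> would form a sequence that converges to the given
  network and stays outside \<open>S\<close>. Radius and precision are tied to
  a single index so that finitely many such conditions hold together for all large indices.\<close>

lemma open_birootedD:
  fixes S :: "'m::metric_space birooted set"
  assumes S: "open S" and G: "birooted_network (G, u, v)" and x: "brclass G u v \<in> S"
  shows "\<forall>\<^sub>F n in sequentially. \<forall>H w z. birooted_network (H, w, z) \<longrightarrow>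
    birooted_close n (1 / Suc n) G u v H w z \<longrightarrow> brclass H w z \<in> S"
proof (rule ccontr)
  define bad where "bad n H w z \<longleftrightarrow> birooted_network (H, w, z) \<and>
    birooted_close n (1 / Suc n) G u v H w z \<and> brclass H w z \<notin> S" for n H w z
  define A where "A = {n. \<exists>H w z. bad n H w z}"
  assume "\<not> ?thesis"
  then have inf: "\<exists>n\<ge>N. n \<in> A" for N
    unfolding eventually_sequentially A_def bad_def by blast
  then obtain k where k: "N \<le> k N" "k N \<in> A" for N
    by metis
  then have "\<exists>H w z. bad (k N) H w z" for N
    by (simp add: A_def)
  then obtain Hs ws zs where b: "bad (k N) (Hs N) (ws N) (zs N)" for N
    by metis
  have net: "birooted_network (Hs N, ws N, zs N)" for N
    using b by (auto simp: bad_def)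
  have "((\<lambda>N. brclass (Hs N) (ws N) (zs N)) \<longlongrightarrow> brclass G u v) sequentially"
    unfolding tendsto_brclass_iff[OF G net]
  proof (intro allI impI)
    fix r and \<epsilon> :: real assume "\<epsilon> > 0"
    then obtain m where m: "1 / real (Suc m) < \<epsilon>"
      using nat_approx_posE by blast
    show "\<forall>\<^sub>F N in sequentially. birooted_close r \<epsilon> G u v (Hs N) (ws N) (zs N)"
      using eventually_ge_at_top[of "max r m"]
    proof eventually_elim
      case (elim N)
      then have "r \<le> k N" "1 / real (Suc (k N)) \<le> 1 / real (Suc m)"
        using k[of N] by (auto intro!: divide_left_mono)
      with m have "r \<le> k N" "1 / real (Suc (k N)) \<le> \<epsilon>"
        by auto
      then show ?case
        using b[of N] G ball_match_mono[where r = r and \<epsilon>' = \<epsilon>]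
        unfolding bad_def birooted_close_iff rooted_network.simps birooted_network.simps by metis
    qed
  qed
  then have "\<forall>\<^sub>F N in sequentially. brclass (Hs N) (ws N) (zs N) \<in> S"
    by (rule topological_tendstoD[OF _ S x])
  then show False
    using b by (auto simp: bad_def eventually_sequentially)
qed

section \<open>The two roots of a doubly-rooted network\<close>

definition src :: "'m birooted \<Rightarrow> 'm rooted" where
  "src x = (case rep_birooted x of (G, u, v) \<Rightarrow> rclass G u)"

definition swap :: "'m birooted \<Rightarrow> 'm birooted" where
  "swap x = (case rep_birooted x of (G, u, v) \<Rightarrow> brclass G v u)"

abbreviation tgt :: "'m birooted \<Rightarrow> 'm rooted" where
  "tgt x \<equiv> src (swap x)"

definition within_dist :: "nat \<Rightarrow> 'm birooted set" where
  "within_dist r = {x. case rep_birooted x of (G, u, v) \<Rightarrow> v \<in> ball_verts G u r}"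

lemma rep_brclass:
  assumes "birooted_network (G, u, v)"
  obtains H w z \<phi> \<psi> where "rep_birooted (brclass G u v) = (H, w, z)" "birooted_network (H, w, z)"
    "network_iso \<phi> \<psi> H G" "\<phi> w = u" "\<phi> z = v"
proof -
  obtain H w z where r: "rep_birooted (brclass G u v) = (H, w, z)"
    by (metis prod_cases3)
  have "birooted_iso (H, w, z) (G, u, v)"
    using Quotient3_rep_abs[OF Quotient3_birooted birooted_iso_refl[OF assms]] r by simp
  then show ?thesis
    using that r by auto
qed

lemma src_brclass [simp]:
  assumes "birooted_network (G, u, v)"
  shows "src (brclass G u v) = rclass G u"
proof -
  obtain H w z \<phi> \<psi> where "rep_birooted (brclass G u v) = (H, w, z)" "birooted_network (H, w, z)"
    "network_iso \<phi> \<psi> H G" "\<phi> w = u"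
    using rep_brclass[OF assms] by metis
  then show ?thesis
    using assms by (auto simp: src_def rclass_eq_iff)
qed

lemma swap_brclass [simp]:
  assumes "birooted_network (G, u, v)"
  shows "swap (brclass G u v) = brclass G v u"
proof -
  obtain H w z \<phi> \<psi> where "rep_birooted (brclass G u v) = (H, w, z)" "birooted_network (H, w, z)"
    "network_iso \<phi> \<psi> H G" "\<phi> w = u" "\<phi> z = v"
    using rep_brclass[OF assms] by metis
  then show ?thesis
    using assms by (auto simp: swap_def brclass_eq_iff)
qed

lemma swap_swap [simp]: "swap (swap x) = x"
  by (cases x rule: birooted_cases) simp

lemma brclass_within_dist_iff:
  assumes "birooted_network (G, u, v)"
  shows "brclass G u v \<in> within_dist r \<longleftrightarrow> v \<in> ball_verts G u r"
proof -
  obtain H w z \<phi> \<psi> where r: "rep_birooted (brclass G u v) = (H, w, z)" and H: "birooted_network (H, w, z)"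
    and i: "network_iso \<phi> \<psi> H G" "\<phi> w = u" "\<phi> z = v"
    using rep_brclass[OF assms] by metis
  have "\<phi> ` ball_verts H w r = ball_verts G u r"
    using graph_iso_ball_verts[of \<phi> \<psi> H G w r] i H assms by (simp add: network_iso_def)
  moreover have "inj_on \<phi> (verts H)" "ball_verts H w r \<subseteq> verts H"
    using i H by (auto simp: network_iso_def graph_iso_def bij_betw_def dest: ball_verts_subset)
  ultimately have "z \<in> ball_verts H w r \<longleftrightarrow> v \<in> ball_verts G u r"
    using i(3) H inj_on_image_mem_iff[of \<phi> "verts H" z "ball_verts H w r"] by simp
  then show ?thesis
    by (simp add: within_dist_def r)
qed

lemma swap_within_dist_iff [simp]: "swap x \<in> within_dist r \<longleftrightarrow> x \<in> within_dist r"
  by (cases x rule: birooted_cases) (simp add: brclass_within_dist_iff ball_verts_sym)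

lemma within_dist_exhausts: "\<exists>r. x \<in> within_dist r"
proof (cases x rule: birooted_cases)
  case (1 G u v)
  then have "(u, v) \<in> (adj G)\<^sup>*"
    by (simp add: is_network_def)
  then obtain r where "(u, v) \<in> adj G ^^ r"
    by (auto simp: rtrancl_power)
  then show ?thesis
    using 1 by (auto simp: brclass_within_dist_iff ball_verts_def)
qed

lemma within_dist_mono: "r \<le> R \<Longrightarrow> within_dist r \<subseteq> within_dist R"
  unfolding within_dist_def by (auto intro: ball_verts_mono)

lemma open_within_dist: "open (within_dist r :: 'm::metric_space birooted set)"
proof (rule open_birootedI)
  fix G :: "(nat, nat, 'm) network" and u v
  assume "birooted_network (G, u, v)" "brclass G u v \<in> within_dist r"
  then show "\<exists>R \<epsilon>. 0 < \<epsilon> \<and> v \<in> ball_verts G u R \<and> (\<forall>H w z. birooted_network (H, w, z) \<longrightarrow>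
      birooted_close R \<epsilon> G u v H w z \<longrightarrow> brclass H w z \<in> within_dist r)"
    by (intro exI[of _ r] exI[of _ 1])
      (auto simp del: birooted_network.simps simp: brclass_within_dist_iff intro: birooted_close_in_ball)
qed

text \<open>Convergence of doubly-rooted networks only sees balls that contain the second root, so a radius
  for the rooted network must first be enlarged to reach it.\<close>

lemma continuous_src: "continuous_on UNIV (src :: 'm::metric_space birooted \<Rightarrow> 'm rooted)"
proof -
  have "(src \<longlongrightarrow> src x) (at x)" for x :: "'m birooted"
  proof (cases x rule: birooted_cases)
    case (1 G u v)
    define Gs us vs where "Gs y = fst (rep_birooted y)" and "us y = fst (snd (rep_birooted y))"
      and "vs y = snd (snd (rep_birooted y))" for y :: "'m birooted"
    have net: "birooted_network (Gs y, us y, vs y)" and y: "brclass (Gs y) (us y) (vs y) = y" for y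
      using rep_birooted[of y] Quotient3_abs_rep[OF Quotient3_birooted, of y]
      by (cases "rep_birooted y"; simp add: Gs_def us_def vs_def)+
    have G: "rooted_network (G, u)" and net': "rooted_network (Gs y, us y)" for y
      using 1 net[of y] by auto
    have src: "src y = rclass (Gs y) (us y)" for y
      using src_brclass[OF net[of y]] by (simp add: y)
    have "((\<lambda>y. brclass (Gs y) (us y) (vs y)) \<longlongrightarrow> brclass G u v) (at x)"
      unfolding y 1(2)[symmetric] by (rule tendsto_ident_at)
    then have lim: "v \<in> ball_verts G u r \<Longrightarrow> \<epsilon> > 0 \<Longrightarrow>
        \<forall>\<^sub>F y in at x. birooted_close r \<epsilon> G u v (Gs y) (us y) (vs y)" for r \<epsilon>
      unfolding tendsto_brclass_iff[OF 1(1) net] by blast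
    have "((\<lambda>y. rclass (Gs y) (us y)) \<longlongrightarrow> rclass G u) (at x)"
      unfolding tendsto_rclass_iff[OF G net']
    proof (intro allI impI)
      fix r and \<epsilon> :: real assume \<epsilon>: "\<epsilon> > 0"
      obtain d where "v \<in> ball_verts G u d"
        using within_dist_exhausts brclass_within_dist_iff[OF 1(1)] by blast
      then have "v \<in> ball_verts G u (d + r)"
        by (rule ball_verts_mono) simp
      from lim[OF this \<epsilon>] show "\<forall>\<^sub>F y in at x. rooted_close r \<epsilon> G u (Gs y) (us y)"
      proof eventually_elim
        case (elim y)
        then show ?case
          unfolding birooted_close_iff rooted_close_iff
          using ball_match_mono[OF _ G net', of "d + r" \<epsilon> _ _ y r \<epsilon>] by auto
      qed
    qed
    then show ?thesis
      unfolding src src_brclass[OF 1(1), folded 1(2), unfolded src] .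
  qed
  then show ?thesis
    by (simp add: continuous_on_def)
qed

text \<open>If the roots are at distance at most \<open>d\<close>, then a match of the balls of radius \<open>d + n\<close> about the
  first roots contains a match of the balls of radius \<open>n\<close> about the second roots.\<close>

lemma continuous_swap: "continuous_on UNIV (swap :: 'm::metric_space birooted \<Rightarrow> 'm birooted)"
  unfolding continuous_on_open_vimage[OF open_UNIV]
proof (intro allI impI)
  fix S :: "'m birooted set" assume S: "open S"
  have "open (swap -` S)"
  proof (rule open_birootedI)
    fix G :: "(nat, nat, 'm) network" and u v
    assume G: "birooted_network (G, u, v)" and "brclass G u v \<in> swap -` S"
    then have "brclass G v u \<in> S" "birooted_network (G, v, u)"
      by auto
    then obtain n where n: "birooted_network (H, z, w) \<Longrightarrow>
      birooted_close n (1 / Suc n) G v u H z w \<Longrightarrow> brclass H z w \<in> S" for H w z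
      using open_birootedD[OF S, of G v u] unfolding eventually_sequentially by blast
    obtain d where d: "v \<in> ball_verts G u d"
      using within_dist_exhausts brclass_within_dist_iff[OF G] by blast
    show "\<exists>R \<epsilon>. 0 < \<epsilon> \<and> v \<in> ball_verts G u R \<and> (\<forall>H w z. birooted_network (H, w, z) \<longrightarrow>
      birooted_close R \<epsilon> G u v H w z \<longrightarrow> brclass H w z \<in> swap -` S)"
    proof (intro exI[of _ "d + n"] exI[of _ "1 / real (Suc n)"] conjI allI impI)
      show "v \<in> ball_verts G u (d + n)"
        using d by (rule ball_verts_mono) simp
      fix H :: "(nat, nat, 'm) network" and w z
      assume H: "birooted_network (H, w, z)" and "birooted_close (d + n) (1 / real (Suc n)) G u v H w z"
      then obtain \<phi> \<psi> where m: "ball_match (d + n) (1 / real (Suc n)) \<phi> \<psi> G u H w" and z: "\<phi> v = z"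
        unfolding birooted_close_iff by blast
      have "ball_match n (1 / real (Suc n)) \<phi> \<psi> G v H (\<phi> v)"
        using G H by (intro ball_match_shift[OF m _ _ d]) auto
      moreover have "\<phi> u = w"
        using m by (simp add: ball_match_def)
      ultimately have "birooted_close n (1 / Suc n) G v u H z w"
        using z unfolding birooted_close_iff by blast
      then show "brclass H w z \<in> swap -` S"
        using n[of H z w] H by simp
    qed simp
  qed
  then show "open (swap -` S \<inter> UNIV)"
    by simp
qed

lemma measurable_src [measurable]: "src \<in> borel_measurable borel"
  by (rule borel_measurable_continuous_onI[OF continuous_src])

lemma measurable_swap [measurable]: "swap \<in> borel_measurable borel"
  by (rule borel_measurable_continuous_onI[OF continuous_swap])

lemma measurable_within_dist [measurable]: "within_dist r \<in> sets borel"
  by (rule borel_open[OF open_within_dist])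

section \<open>Sums over the second root are measurable\<close>

text \<open>The total mass sent by the root. Kernels take extended nonnegative values here, so that all sums and
  monotone limits exist. Mass received is mass sent by the kernel with its two roots exchanged.\<close>

definition out_sum :: "('m birooted \<Rightarrow> ennreal) \<Rightarrow> 'm rooted \<Rightarrow> ennreal" where
  "out_sum F x = (case rep_rooted x of (G, u) \<Rightarrow>
     \<integral>\<^sup>+v. F (brclass G u v) \<partial>count_space (verts G))"

abbreviation in_sum :: "('m birooted \<Rightarrow> ennreal) \<Rightarrow> 'm rooted \<Rightarrow> ennreal" where
  "in_sum F \<equiv> out_sum (\<lambda>x. F (swap x))"

lemma out_sum_rclass:
  assumes "rooted_network (G, u)"
  shows "out_sum F (rclass G u) = (\<integral>\<^sup>+v. F (brclass G u v) \<partial>count_space (verts G))"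
proof -
  obtain H w where r: "rep_rooted (rclass G u) = (H, w)"
    by fastforce
  have "rooted_iso (H, w) (G, u)"
    using Quotient3_rep_abs[OF Quotient3_rooted rooted_iso_refl[OF assms]] r by simp
  then obtain \<phi> \<psi> where i: "network_iso \<phi> \<psi> H G" "\<phi> w = u" and H: "is_network H" "w \<in> verts H"
    by auto
  then have b: "bij_betw \<phi> (verts H) (verts G)"
    by (auto simp: network_iso_def graph_iso_def)
  have "brclass H w v = brclass G u (\<phi> v)" if "v \<in> verts H" for v
    using that i H assms bij_betwE[OF b] by (subst brclass_eq_iff) auto
  then show ?thesis
    unfolding out_sum_def r prod.case nn_integral_bij_count_space[OF b, symmetric]
    by (intro nn_integral_cong) simp
qed

lemma in_sum_rclass:
  assumes "rooted_network (G, u)"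
  shows "in_sum F (rclass G u) = (\<integral>\<^sup>+v. F (brclass G v u) \<partial>count_space (verts G))"
  unfolding out_sum_rclass[OF assms] using assms by (intro nn_integral_cong) simp

lemma out_sum_cong:
  assumes "\<And>y. src y = x \<Longrightarrow> F y = F' y"
  shows "out_sum F x = out_sum F' x"
proof (cases x rule: rooted_cases)
  case (1 G u)
  then show ?thesis
    using assms by (auto simp: out_sum_rclass intro!: nn_integral_cong)
qed

lemma out_sum_mono:
  assumes "\<And>y. src y = x \<Longrightarrow> F y \<le> F' y"
  shows "out_sum F x \<le> out_sum F' x"
proof (cases x rule: rooted_cases)
  case (1 G u)
  then show ?thesis
    using assms by (auto simp: out_sum_rclass intro!: nn_integral_mono)
qed

lemma out_sum_add: "out_sum (\<lambda>y. F y + F' y) x = out_sum F x + out_sum F' x"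
  by (cases x rule: rooted_cases) (simp add: out_sum_rclass nn_integral_add)

lemma out_sum_cmult: "out_sum (\<lambda>y. c * F y) x = c * out_sum F x"
  by (cases x rule: rooted_cases) (simp add: out_sum_rclass nn_integral_cmult)

lemma out_sum_SUP:
  assumes "\<And>y. incseq (\<lambda>n. F n y)"
  shows "out_sum (\<lambda>y. SUP n. F n y) x = (SUP n. out_sum (F n) x)"
proof (cases x rule: rooted_cases)
  case (1 G u)
  then show ?thesis
    using assms unfolding 1 out_sum_rclass[OF 1(1)]
    by (intro nn_integral_monotone_convergence_SUP) (auto simp: incseq_def le_fun_def)
qed

lemma out_sum_zero_iff:
  assumes G: "rooted_network (G, u)"
  shows "out_sum F (rclass G u) = 0 \<longleftrightarrow> (\<forall>v\<in>verts G. F (brclass G u v) = 0)"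
  unfolding out_sum_rclass[OF G] by (simp add: nn_integral_0_iff_AE AE_count_space)

lemma le_out_sum: "F y \<le> out_sum F (src y)"
proof (cases y rule: birooted_cases)
  case (1 G u v)
  then have "F y = (\<integral>\<^sup>+w. F (brclass G u w) * indicator {v} w \<partial>count_space (verts G))"
    by (subst nn_integral_indicator_singleton) auto
  also have "\<dots> \<le> out_sum F (src y)"
    using 1 by (auto simp: out_sum_rclass indicator_def intro!: nn_integral_mono)
  finally show ?thesis .
qed

text \<open>Restricting to a ball makes the count finite; this is needed for the complement step of the Dynkin
  argument below.\<close>

lemma out_sum_indicator_within_dist:
  assumes G: "rooted_network (G, u)"
  shows "out_sum (indicator (within_dist r \<inter> B)) (rclass G u) =
    of_nat (card {v \<in> ball_verts G u r. brclass G u v \<in> B})"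
proof -
  let ?Z = "{v \<in> ball_verts G u r. brclass G u v \<in> B}"
  have sub: "ball_verts G u r \<subseteq> verts G" and fin: "finite (ball_verts G u r)"
    using G ball_verts_subset[of G u r] finite_ball_verts by auto
  have "out_sum (indicator (within_dist r \<inter> B)) (rclass G u) =
      (\<integral>\<^sup>+v. indicator ?Z v \<partial>count_space (verts G))"
    unfolding out_sum_rclass[OF G]
    using G by (intro nn_integral_cong) (simp add: indicator_def brclass_within_dist_iff)
  also have "\<dots> = emeasure (count_space (verts G)) ?Z"
    using sub by (intro nn_integral_indicator) auto
  also have "\<dots> = of_nat (card ?Z)"
    using sub fin by (intro emeasure_count_space_finite) auto
  finally show ?thesis .
qed

text \<open>Lower semicontinuity of the number of vertices \<open>v\<close> near the root with \<open>[G, u, v] \<in> B\<close>: each of the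
  finitely many vertices counted for \<open>G\<close> stays in the open set \<open>B\<close> under a small perturbation, and an
  approximate isomorphism of balls maps different vertices to different vertices.\<close>

lemma open_out_sum_greater:
  fixes B :: "'m::metric_space birooted set"
  assumes B: "open B"
  shows "open {x. c < out_sum (indicator (within_dist r \<inter> B)) x}"
proof (rule open_rootedI)
  fix G :: "(nat, nat, 'm) network" and u
  assume G: "rooted_network (G, u)" and c: "rclass G u \<in> {x. c < out_sum (indicator (within_dist r \<inter> B)) x}"
  define Z where "Z = {v \<in> ball_verts G u r. brclass G u v \<in> B}"
  have Zsub: "Z \<subseteq> ball_verts G u r" and bsub: "ball_verts G u r \<subseteq> verts G" and fin: "finite Z"
    using G ball_verts_subset[of G u r] finite_ball_verts[of G u r] by (auto simp: Z_def)
  have "\<forall>\<^sub>F n in sequentially. \<forall>H w z. birooted_network (H, w, z) \<longrightarrow>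
    birooted_close n (1 / Suc n) G u v H w z \<longrightarrow> brclass H w z \<in> B" if "v \<in> Z" for v
    using that G bsub by (intro open_birootedD[OF B]) (auto simp: Z_def)
  then have "\<forall>\<^sub>F n in sequentially. \<forall>v\<in>Z. \<forall>H w z. birooted_network (H, w, z) \<longrightarrow>
    birooted_close n (1 / Suc n) G u v H w z \<longrightarrow> brclass H w z \<in> B"
    by (intro eventually_ball_finite[OF fin] ballI)
  then have "\<forall>\<^sub>F n in sequentially. r \<le> n \<and> (\<forall>v\<in>Z. \<forall>H w z. birooted_network (H, w, z) \<longrightarrow>
    birooted_close n (1 / Suc n) G u v H w z \<longrightarrow> brclass H w z \<in> B)"
    by (intro eventually_conj eventually_ge_at_top)
  then obtain n where rn: "r \<le> n" and n: "\<And>v H w z. v \<in> Z \<Longrightarrow> birooted_network (H, w, z) \<Longrightarrow>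
    birooted_close n (1 / Suc n) G u v H w z \<Longrightarrow> brclass H w z \<in> B"
    unfolding eventually_sequentially by blast
  have "rclass H w \<in> {x. c < out_sum (indicator (within_dist r \<inter> B)) x}"
    if H: "rooted_network (H, w)" and close: "rooted_close n (1 / Suc n) G u H w" for H w
  proof -
    obtain \<phi> \<psi> where m: "ball_match n (1 / Suc n) \<phi> \<psi> G u H w"
      using close unfolding rooted_close_iff by blast
    define Z' where "Z' = {z \<in> ball_verts H w r. brclass H w z \<in> B}"
    have in_ball: "\<phi> v \<in> ball_verts H w r" if "v \<in> Z" for v
      using ball_match_image(2)[OF m G H, of v r 0] that Zsub rn by auto
    have "\<phi> v \<in> Z'" if v: "v \<in> Z" for v
    proof -
      have "birooted_network (H, w, \<phi> v)"
        using in_ball[OF v] H ball_verts_subset[of H w r] by auto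
      moreover have "birooted_close n (1 / Suc n) G u v H w (\<phi> v)"
        unfolding birooted_close_iff using m by blast
      ultimately show ?thesis
        using n[OF v] in_ball[OF v] by (simp add: Z'_def)
    qed
    then have "\<phi> ` Z \<subseteq> Z'"
      by blast
    moreover have "inj_on \<phi> (ball_verts G u n)"
      using m by (simp add: ball_match_def graph_iso_def net_ball_def bij_betw_def)
    then have "inj_on \<phi> Z"
      by (rule inj_on_subset) (use Zsub rn in \<open>auto intro: ball_verts_mono\<close>)
    moreover have "finite Z'"
      using H finite_ball_verts[of H w r] by (auto simp: Z'_def)
    ultimately have "card Z \<le> card Z'"
      by (metis card_image card_mono)
    then have "(of_nat (card Z) :: ennreal) \<le> of_nat (card Z')"
      by (simp only: of_nat_le_iff)
    with c show ?thesis
      unfolding mem_Collect_eq out_sum_indicator_within_dist[OF G] out_sum_indicator_within_dist[OF H]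
        Z_def[symmetric] Z'_def[symmetric] by (rule less_le_trans)
  qed
  then show "\<exists>R \<epsilon>. \<epsilon> > 0 \<and> (\<forall>H w. rooted_network (H, w) \<longrightarrow> rooted_close R \<epsilon> G u H w \<longrightarrow>
      rclass H w \<in> {x. c < out_sum (indicator (within_dist r \<inter> B)) x})"
    by (intro exI[of _ n] exI[of _ "1 / real (Suc n)"]) auto
qed

text \<open>Open sets are stable under intersection and generate the Borel sets, so the semicontinuous case
  extends by Dynkin's theorem.\<close>

lemma measurable_out_sum_indicator:
  fixes B :: "'m::metric_space birooted set"
  assumes "B \<in> sets borel"
  shows "out_sum (indicator (within_dist r \<inter> B)) \<in> borel_measurable borel"
proof -
  have open_case: "out_sum (indicator (within_dist r \<inter> S)) \<in> borel_measurable borel"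
    if "open S" for S :: "'m birooted set"
    by (rule borel_measurableI_greater) (simp add: borel_open open_out_sum_greater[OF that])
  have "Int_stable {S :: 'm birooted set. open S}" "{S :: 'm birooted set. open S} \<subseteq> Pow UNIV"
    and "B \<in> sigma_sets UNIV {S. open S}"
    using assms by (auto simp: borel_def Int_stable_def)
  then show ?thesis
  proof (induction B rule: sigma_sets_induct_disjoint)
    case (compl A)
    have "out_sum (indicator (within_dist r \<inter> (UNIV - A))) x =
        out_sum (indicator (within_dist r \<inter> UNIV)) x - out_sum (indicator (within_dist r \<inter> A)) x" for x
    proof -
      have "out_sum (indicator (within_dist r \<inter> UNIV)) x =
        out_sum (\<lambda>y. indicator (within_dist r \<inter> (UNIV - A)) y + indicator (within_dist r \<inter> A) y) x"
        by (intro out_sum_cong) (auto simp: indicator_def)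
      moreover have "out_sum (indicator (within_dist r \<inter> A)) x < \<top>"
        by (cases x rule: rooted_cases) (simp add: out_sum_indicator_within_dist of_nat_less_top)
      ultimately show ?thesis
        by (simp add: out_sum_add ennreal_add_diff_cancel_right less_top)
    qed
    then show ?case
      using compl open_case[OF open_UNIV] by (simp add: borel_measurable_minus_ennreal cong: measurable_cong)
  next
    case (union A)
    have "out_sum (indicator (within_dist r \<inter> (\<Union>i. A i))) x =
        (\<Sum>i. out_sum (indicator (within_dist r \<inter> A i)) x)" for x
    proof (cases x rule: rooted_cases)
      case (1 G u)
      have "indicator (within_dist r \<inter> (\<Union>i. A i)) y =
          (\<Sum>i. indicator (within_dist r \<inter> A i) y :: ennreal)" for y
      proof -
        have "disjoint_family (\<lambda>i. within_dist r \<inter> A i)"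
          using union(1) by (auto simp: disjoint_family_on_def)
        from suminf_indicator[OF this] show ?thesis
          by simp
      qed
      then show ?thesis
        unfolding 1 out_sum_rclass[OF 1(1)] by (simp add: nn_integral_suminf)
    qed
    then show ?case
      using union by (simp cong: measurable_cong)
  next
    case empty
    have "out_sum (\<lambda>_. 0) x = 0" for x :: "'m rooted"
      by (cases x rule: rooted_cases) (simp add: out_sum_rclass)
    then have "out_sum (\<lambda>_. 0) = (\<lambda>x :: 'm rooted. 0)"
      by (rule ext)
    then show ?case
      by simp
  qed (auto intro: open_case)
qed

text \<open>Every vertex is at finite distance from the root, so the full sum is the supremum of the sums over
  balls, which are treated by approximation with simple functions.\<close>

lemma measurable_out_sum [measurable]:
  fixes F :: "'m::metric_space birooted \<Rightarrow> ennreal"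
  assumes "F \<in> borel_measurable borel"
  shows "out_sum F \<in> borel_measurable borel"
proof -
  have ball: "out_sum (\<lambda>y. indicator (within_dist r) y * F y) \<in> borel_measurable borel" for r
    using assms
  proof (induction rule: borel_measurable_induct)
    case (cong f g)
    then show ?case by (simp add: fun_eq_iff )
  next
    case (set A)
    have "out_sum (\<lambda>y. indicator (within_dist r) y * indicator A y) = out_sum (indicator (within_dist r \<inter> A))"
      by (intro ext out_sum_cong) (simp add: indicator_def)
    then show ?case
      using measurable_out_sum_indicator[OF set] by simp
  next
    case (mult f c)
    have "out_sum (\<lambda>y. indicator (within_dist r) y * (c * f y)) x =
        c * out_sum (\<lambda>y. indicator (within_dist r) y * f y) x" for x
      unfolding out_sum_cmult[symmetric] by (intro out_sum_cong) (simp add: mult_ac)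
    then show ?case
      using mult by (simp cong: measurable_cong)
  next
    case (add f g)
    have "out_sum (\<lambda>y. indicator (within_dist r) y * (f y + g y)) x =
        out_sum (\<lambda>y. indicator (within_dist r) y * f y) x + out_sum (\<lambda>y. indicator (within_dist r) y * g y) x" for x
      unfolding out_sum_add[symmetric] by (intro out_sum_cong) (simp add: distrib_left)
    then show ?case
      using add by (simp add: add.commute cong: measurable_cong)
  next
    case (seq U)
    have "out_sum (\<lambda>y. indicator (within_dist r) y * (SUP i. U i) y) x =
        (SUP i. out_sum (\<lambda>y. indicator (within_dist r) y * U i y) x)" for x
      using seq(3) by (subst out_sum_SUP[symmetric])
        (auto simp: incseq_def le_fun_def image_comp SUP_mult_left_ennreal intro!: mult_left_mono out_sum_cong)
    then show ?case
      using seq by (simp cong: measurable_cong)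
  qed
  have "out_sum F x = (SUP r. out_sum (\<lambda>y. indicator (within_dist r) y * F y) x)" for x
  proof -
    have "F y = (SUP r. indicator (within_dist r) y * F y)" for y
    proof (rule antisym)
      obtain r where "y \<in> within_dist r"
        using within_dist_exhausts by blast
      then show "F y \<le> (SUP r. indicator (within_dist r) y * F y)"
        by (intro SUP_upper2[of r]) auto
    qed (auto intro!: SUP_least simp: indicator_def)
    moreover have "incseq (\<lambda>r. indicator (within_dist r) y * F y)" for y
      using within_dist_mono by (auto simp: incseq_def indicator_def)
    ultimately show ?thesis
      by (subst out_sum_SUP[symmetric]) (auto intro: out_sum_cong)
  qed
  then show ?thesis
    using ball by (simp cong: measurable_cong)
qed

section \<open>The greedy transport\<close>

definition nbhd_sum :: "nat \<Rightarrow> ('m rooted \<Rightarrow> ennreal) \<Rightarrow> 'm rooted \<Rightarrow> ennreal" where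
  "nbhd_sum r f = out_sum (\<lambda>y. indicator (within_dist r) y * f (tgt y))"

text \<open>One round of bargaining. Each vertex \<open>u\<close> splits its supply \<open>a(u)\<close> among the demands \<open>b(v)\<close> within
  distance \<open>r\<close> in proportion to them, offering \<open>a(u) b(v) / \<Sum>b\<close>; symmetrically \<open>v\<close> asks for
  \<open>a(u) b(v) / \<Sum>a\<close>; the smaller amount is moved. The formula is equivariant, so no choice between
  symmetric vertices is ever made. Since \<open>0 / 0 = 0\<close>, nothing is moved if there is no supply
  or no demand.\<close>

definition greedy_step ::
    "nat \<Rightarrow> ('m rooted \<Rightarrow> ennreal) \<Rightarrow> ('m rooted \<Rightarrow> ennreal) \<Rightarrow> 'm birooted \<Rightarrow> ennreal" where
  "greedy_step r a b y = indicator (within_dist r) y *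
     (a (src y) * b (tgt y) / max (nbhd_sum r b (src y)) (nbhd_sum r a (tgt y)))"

lemma greedy_step_swap: "greedy_step r a b (swap y) = greedy_step r b a y"
  by (simp add: greedy_step_def max.commute mult.commute indicator_def)

lemma ennreal_mult_divide_le: "(a :: ennreal) * b / b \<le> a"
  by (cases "b = 0 \<or> b = \<top>") (auto simp: mult_divide_eq_ennreal)

lemma ennreal_inverse_antimono: "x \<le> y \<Longrightarrow> inverse y \<le> inverse (x :: ennreal)"
  by (cases x; cases y; cases "x = 0") (auto simp: inverse_ennreal le_imp_inverse_le ennreal_le_iff top_unique)

lemma nbhd_sum_finite:
  fixes f :: "'m rooted \<Rightarrow> ennreal"
  assumes "\<And>x. f x < \<top>"
  shows "nbhd_sum r f x < \<top>"
proof (cases x rule: rooted_cases)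
  case (1 G u)
  have fin: "finite (ball_verts G u r)" and sub: "ball_verts G u r \<subseteq> verts G"
    using 1 finite_ball_verts ball_verts_subset[of G u r] by auto
  have "nbhd_sum r f x = (\<integral>\<^sup>+v. f (rclass G v) * indicator (ball_verts G u r) v \<partial>count_space (verts G))"
    unfolding nbhd_sum_def 1 out_sum_rclass[OF 1(1)] using 1
    by (intro nn_integral_cong) (simp add: brclass_within_dist_iff indicator_def)
  also have "\<dots> = (\<Sum>v\<in>ball_verts G u r. f (rclass G v))"
    using fin sub by (subst nn_integral_count_space'[of "ball_verts G u r"]) (auto simp: Int_absorb2)
  also have "\<dots> < \<top>"
    using fin assms by (simp add: less_top[symmetric])
  finally show ?thesis .
qed

text \<open>Replacing the maximum in the denominator by its first argument turns the amounts sent by one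
  vertex into shares of its supply that add up to at most that supply.\<close>

lemma out_sum_greedy_step: "out_sum (greedy_step r a b) x \<le> a x"
proof -
  have "out_sum (greedy_step r a b) x \<le>
      out_sum (\<lambda>y. a x / nbhd_sum r b x * (indicator (within_dist r) y * b (tgt y))) x"
  proof (rule out_sum_mono)
    fix y :: "'a birooted" assume y: "src y = x"
    have "a x * b (tgt y) / max (nbhd_sum r b x) (nbhd_sum r a (tgt y)) \<le> a x * b (tgt y) / nbhd_sum r b x"
      by (simp add: divide_ennreal_def mult_left_mono ennreal_inverse_antimono)
    then show "greedy_step r a b y \<le> a x / nbhd_sum r b x * (indicator (within_dist r) y * b (tgt y))"
      using y by (simp add: greedy_step_def indicator_def divide_ennreal_def mult_ac)
  qed
  also have "\<dots> = a x * nbhd_sum r b x / nbhd_sum r b x"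
    unfolding out_sum_cmult nbhd_sum_def[symmetric] by (simp add: divide_ennreal_def mult_ac)
  also have "\<dots> \<le> a x"
    by (rule ennreal_mult_divide_le)
  finally show ?thesis .
qed

text \<open>Each round distributes what the earlier rounds left over. The radius is the second component of the
  pair coded by \<open>n\<close>, so every radius is used infinitely often.\<close>

primrec greedy :: "('m rooted \<Rightarrow> ennreal) \<Rightarrow> ('m rooted \<Rightarrow> ennreal) \<Rightarrow> nat \<Rightarrow> 'm birooted \<Rightarrow> ennreal" where
  "greedy f g 0 = (\<lambda>y. 0)"
| "greedy f g (Suc n) = (\<lambda>y. greedy f g n y +
     greedy_step (snd (prod_decode n))
       (\<lambda>x. f x - out_sum (greedy f g n) x) (\<lambda>x. g x - in_sum (greedy f g n) x) y)"

lemma out_sum_greedy_le: "out_sum (greedy f g n) x \<le> f x"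
proof (induction n)
  case 0
  show ?case
    using out_sum_cmult[of 0 "\<lambda>_. 0" x] by simp
next
  case (Suc n)
  have "out_sum (greedy f g (Suc n)) x \<le> out_sum (greedy f g n) x + (f x - out_sum (greedy f g n) x)"
    unfolding greedy.simps out_sum_add by (intro add_left_mono out_sum_greedy_step)
  also have "\<dots> = f x"
    using Suc by (simp add: diff_add_cancel_ennreal add.commute)
  finally show ?case .
qed

lemma greedy_swap: "greedy f g n (swap y) = greedy g f n y"
proof (induction n arbitrary: y)
  case (Suc n)
  have "(\<lambda>x. greedy f g n (swap x)) = greedy g f n" "(\<lambda>x. greedy g f n (swap x)) = greedy f g n"
    using Suc Suc[of "swap x" for x] by (auto simp: fun_eq_iff)
  then show ?case
    by (simp add: greedy_step_swap Suc)
qed simp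

lemma in_sum_greedy_le: "in_sum (greedy f g n) x \<le> g x"
  unfolding greedy_swap by (rule out_sum_greedy_le)

lemma incseq_greedy: "incseq (\<lambda>n. greedy f g n y)"
  by (rule incseq_SucI) simp

lemma measurable_greedy_step [measurable]:
  fixes a b :: "'m::metric_space rooted \<Rightarrow> ennreal"
  assumes [measurable]: "a \<in> borel_measurable borel" "b \<in> borel_measurable borel"
  shows "greedy_step r a b \<in> borel_measurable borel"
  unfolding greedy_step_def nbhd_sum_def by measurable

lemma measurable_greedy [measurable]:
  fixes f g :: "'m::metric_space rooted \<Rightarrow> ennreal"
  assumes [measurable]: "f \<in> borel_measurable borel" "g \<in> borel_measurable borel"
  shows "greedy f g n \<in> borel_measurable borel"
proof (induction n)
  case (Suc n)
  note [measurable] = Suc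
  show ?case
    unfolding greedy.simps by measurable
qed simp

text \<open>The limit of the greedy rounds leaves no supply and demand unsatisfied in the same network. If
  \<open>u\<close> had supply left and \<open>v\<close> had demand left, then in each of the infinitely many rounds with a
  radius \<open>r\<close> that reaches from \<open>u\<close> to \<open>v\<close>, at least a constant \<open>c > 0\<close> would be moved from \<open>u\<close> to \<open>v\<close>:
  the numerator is bounded below by the final leftovers, and the denominator is bounded above by the
  initial finite sums over the two balls. But the total moved from \<open>u\<close> is at most \<open>f(u)\<close>.\<close>

lemma maximal_transport:
  fixes f g :: "'m::metric_space rooted \<Rightarrow> ennreal"
  assumes f [measurable]: "f \<in> borel_measurable borel" and f_fin: "\<And>x. f x < \<top>"
    and g [measurable]: "g \<in> borel_measurable borel" and g_fin: "\<And>x. g x < \<top>"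
  obtains T where "T \<in> borel_measurable borel" "\<And>y. T y < \<top>"
    "\<And>x. out_sum T x \<le> f x" "\<And>x. in_sum T x \<le> g x"
    "\<And>y. out_sum T (src y) = f (src y) \<or> in_sum T (tgt y) = g (tgt y)"
proof
  define T where "T y = (SUP n. greedy f g n y)" for y
  show "T \<in> borel_measurable borel"
    unfolding T_def by measurable
  have out: "out_sum T x = (SUP n. out_sum (greedy f g n) x)" for x
    unfolding T_def by (rule out_sum_SUP[OF incseq_greedy])
  have inn: "in_sum T x = (SUP n. in_sum (greedy f g n) x)" for x
    unfolding T_def by (rule out_sum_SUP[OF incseq_greedy])
  show out_le: "out_sum T x \<le> f x" for x
    unfolding out by (intro SUP_least out_sum_greedy_le)
  show in_le: "in_sum T x \<le> g x" for x
    unfolding inn by (intro SUP_least in_sum_greedy_le)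
  show T_fin: "T y < \<top>" for y
    using le_out_sum[of T y] out_le[of "src y"] f_fin[of "src y"] by (meson le_less_trans)
  show "out_sum T (src y) = f (src y) \<or> in_sum T (tgt y) = g (tgt y)" for y
  proof (rule ccontr)
    assume "\<not> ?thesis"
    then have lt: "out_sum T (src y) < f (src y)" "in_sum T (tgt y) < g (tgt y)"
      using out_le in_le by (auto simp: order.strict_iff_order)
    obtain r where r: "y \<in> within_dist r"
      using within_dist_exhausts by blast
    define c where "c = (f (src y) - out_sum T (src y)) * (g (tgt y) - in_sum T (tgt y)) /
      max (nbhd_sum r g (src y)) (nbhd_sum r f (tgt y))"
    have step: "c \<le> greedy_step r (\<lambda>x. f x - out_sum (greedy f g n) x) (\<lambda>x. g x - in_sum (greedy f g n) x) y" for n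
    proof -
      have "max (nbhd_sum r (\<lambda>x. g x - in_sum (greedy f g n) x) (src y))
            (nbhd_sum r (\<lambda>x. f x - out_sum (greedy f g n) x) (tgt y)) \<le>
          max (nbhd_sum r g (src y)) (nbhd_sum r f (tgt y))"
        unfolding nbhd_sum_def
        by (intro max.mono out_sum_mono mult_left_mono diff_le_self_ennreal) simp_all
      moreover have "(f (src y) - out_sum T (src y)) * (g (tgt y) - in_sum T (tgt y)) \<le>
          (f (src y) - out_sum (greedy f g n) (src y)) * (g (tgt y) - in_sum (greedy f g n) (tgt y))"
        unfolding out inn by (intro mult_mono ennreal_minus_mono SUP_upper) auto
      ultimately show ?thesis
        using r unfolding c_def greedy_step_def divide_ennreal_def
        by (auto intro!: mult_mono simp: ennreal_inverse_antimono)
    qed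
    have "greedy f g m y + c \<le> T y" for m
    proof -
      \<comment> \<open>a later round with radius \<open>r\<close>\<close>
      define n where "n = prod_encode (m, r)"
      have "greedy f g m y + c \<le> greedy f g n y + c"
        using incseq_greedy[of f g y] le_prod_encode_1[of m r] by (auto simp: n_def incseq_def)
      also have "\<dots> \<le> greedy f g (Suc n) y"
        using step[of n] by (simp add: n_def add_left_mono)
      also have "\<dots> \<le> T y"
        unfolding T_def by (rule SUP_upper) simp
      finally show ?thesis .
    qed
    then have "T y + c \<le> T y"
      unfolding T_def[of y] by (subst ennreal_SUP_add_left[symmetric]) (auto intro!: SUP_least)
    then have "c = 0"
      using T_fin[of y] by (cases "T y"; cases c) (auto simp: ennreal_plus[symmetric] top_unique simp del: ennreal_plus)
    moreover have "max (nbhd_sum r g (src y)) (nbhd_sum r f (tgt y)) \<noteq> \<top>"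
      using nbhd_sum_finite[of g, OF g_fin] nbhd_sum_finite[of f, OF f_fin]
      by (metis less_irrefl max_def)
    ultimately show False
      using lt unfolding c_def by (auto simp: ennreal_divide_eq_0_iff diff_eq_0_iff_ennreal)
  qed
qed

section \<open>Mass transport\<close>

lemma mass_out_eq_out_sum:
  assumes "rooted_network (G, u)"
  shows "mass_out T G u = out_sum (\<lambda>y. ennreal (T y)) (rclass G u)"
  by (simp add: out_sum_rclass[OF assms] mass_out_def)

lemma mass_in_eq_in_sum:
  assumes "rooted_network (G, u)"
  shows "mass_in T G u = in_sum (\<lambda>y. ennreal (T y)) (rclass G u)"
  by (simp add: in_sum_rclass[OF assms, of "\<lambda>y. ennreal (T y)"] mass_in_def)

lemma mass_transport:
  fixes X :: "'a \<Rightarrow> 'm::metric_space rooted"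
  assumes uni: "unimodular M X" and F: "F \<in> borel_measurable borel" "\<And>y. F y < \<top>"
  shows "(\<integral>\<^sup>+\<omega>. out_sum F (X \<omega>) \<partial>M) = (\<integral>\<^sup>+\<omega>. in_sum F (X \<omega>) \<partial>M)"
proof -
  define g where "g y = enn2real (F y)" for y
  have gF: "ennreal (g y) = F y" for y
    using F(2) by (simp add: g_def)
  have "root_mass_out g x = out_sum F x" "root_mass_in g x = in_sum F x" for x
    by (cases x rule: rooted_cases;
        simp add: root_mass_rclass mass_out_eq_out_sum mass_in_eq_in_sum gF del: rooted_network.simps)+
  moreover have "g \<in> borel_measurable borel" "\<forall>y. 0 \<le> g y"
    using F(1) by (auto simp: g_def[abs_def])
  then have "(\<integral>\<^sup>+\<omega>. root_mass_out g (X \<omega>) \<partial>M) = (\<integral>\<^sup>+\<omega>. root_mass_in g (X \<omega>) \<partial>M)"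
    using uni unfolding unimodular_def by blast
  ultimately show ?thesis
    by simp
qed

lemma invariant_sets_iff: "A \<in> invariant_sets \<longleftrightarrow> A \<in> sets borel \<and> (\<forall>y. src y \<in> A \<longleftrightarrow> tgt y \<in> A)"
proof
  assume A: "A \<in> invariant_sets"
  then have inv: "rooted_network (G, u) \<Longrightarrow> v \<in> verts G \<Longrightarrow> rclass G u \<in> A \<Longrightarrow> rclass G v \<in> A" for G u v
    unfolding invariant_sets_def by blast
  have "src y \<in> A \<longleftrightarrow> tgt y \<in> A" for y
  proof (cases y rule: birooted_cases)
    case (1 G u v)
    then show ?thesis
      using inv[of G u v] inv[of G v u] by auto
  qed
  with A show "A \<in> sets borel \<and> (\<forall>y. src y \<in> A \<longleftrightarrow> tgt y \<in> A)"
    unfolding invariant_sets_def by blast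
next
  assume A: "A \<in> sets borel \<and> (\<forall>y. src y \<in> A \<longleftrightarrow> tgt y \<in> A)"
  have "rclass G v \<in> A" if "rooted_network (G, u)" "v \<in> verts G" "rclass G u \<in> A" for G u v
    using A[THEN conjunct2, rule_format, of "brclass G u v"] that by simp
  with A show "A \<in> invariant_sets"
    unfolding invariant_sets_def by blast
qed

text \<open>Membership in an invariant set can be tested at either root, so the restriction of a kernel
  to an invariant set is again a kernel.\<close>

lemma mass_transport_invariant:
  fixes X :: "'a \<Rightarrow> 'm::metric_space rooted"
  assumes uni: "unimodular M X" and T [measurable]: "T \<in> borel_measurable borel" and fin: "\<And>y. T y < \<top>"
    and A: "A \<in> invariant_sets"
  shows "(\<integral>\<^sup>+\<omega>. indicator A (X \<omega>) * out_sum T (X \<omega>) \<partial>M) = (\<integral>\<^sup>+\<omega>. indicator A (X \<omega>) * in_sum T (X \<omega>) \<partial>M)"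
proof -
  have [measurable]: "A \<in> sets borel" and inv: "src y \<in> A \<longleftrightarrow> tgt y \<in> A" for y
    using A unfolding invariant_sets_iff by auto
  define F where "F y = indicator A (src y) * T y" for y
  have "out_sum F x = indicator A x * out_sum T x" for x
    unfolding out_sum_cmult[symmetric] F_def by (rule out_sum_cong) simp
  moreover have "in_sum F x = indicator A x * in_sum T x" for x
    unfolding out_sum_cmult[symmetric] F_def by (rule out_sum_cong) (auto simp: indicator_def inv)
  moreover have "F \<in> borel_measurable borel"
    unfolding F_def by measurable
  moreover have "F y < \<top>" for y
    using fin by (auto simp: F_def indicator_def)
  ultimately show ?thesis
    using mass_transport[OF uni, of F] by simp
qed

text \<open>Everything shows at the root: if each vertex sends mass one to every vertex outside \<open>P\<close>, then
  the root almost surely receives nothing, hence on average it sends nothing.\<close>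

lemma AE_root_imp_AE_all_vertices:
  fixes X :: "'a \<Rightarrow> 'm::metric_space rooted"
  assumes uni: "unimodular M X" and [measurable]: "X \<in> M \<rightarrow>\<^sub>M borel" "P \<in> sets borel"
    and AE: "AE \<omega> in M. X \<omega> \<in> P"
  shows "AE \<omega> in M. \<forall>y. src y = X \<omega> \<longrightarrow> tgt y \<in> P"
proof -
  define F :: "'m birooted \<Rightarrow> ennreal" where "F y = indicator (- P) (tgt y)" for y
  have [measurable]: "F \<in> borel_measurable borel"
    unfolding F_def by measurable
  have "in_sum F x = 0" if "x \<in> P" for x
  proof -
    have "in_sum F x = out_sum (\<lambda>y. 0 * 0) x"
      using that by (intro out_sum_cong) (auto simp: F_def)
    then show ?thesis
      unfolding out_sum_cmult by simp
  qed
  then have "(\<integral>\<^sup>+\<omega>. in_sum F (X \<omega>) \<partial>M) = (\<integral>\<^sup>+\<omega>. 0 \<partial>M)"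
    using AE by (intro nn_integral_cong_AE) auto
  then have "(\<integral>\<^sup>+\<omega>. out_sum F (X \<omega>) \<partial>M) = 0"
    by (subst mass_transport[OF uni]) (auto simp: F_def indicator_def)
  then have "AE \<omega> in M. out_sum F (X \<omega>) = 0"
    by (subst (asm) nn_integral_0_iff_AE) auto
  then show ?thesis
  proof eventually_elim
    case (elim \<omega>)
    have "F y = 0" if "src y = X \<omega>" for y
      using le_out_sum[of F y] elim that by simp
    then show ?case
      by (auto simp: F_def indicator_def split: if_splits)
  qed
qed

section \<open>Equal conditional expectations and balancing\<close>

text \<open>Equality of conditional expectations is tested by integrals over the sets of the subalgebra, which
  reduces both directions of the theorem to invariant sets.\<close>

lemma (in sigma_finite_subalgebra) nn_cond_exp_eq_iff:
  assumes f [measurable]: "f \<in> borel_measurable M" and g [measurable]: "g \<in> borel_measurable M"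
  shows "(AE x in M. nn_cond_exp M F f x = nn_cond_exp M F g x) \<longleftrightarrow>
    (\<forall>A\<in>sets F. (\<integral>\<^sup>+x\<in>A. f x \<partial>M) = (\<integral>\<^sup>+x\<in>A. g x \<partial>M))"
proof -
  have int: "(\<integral>\<^sup>+x\<in>A. nn_cond_exp M F h x \<partial>M) = (\<integral>\<^sup>+x\<in>A. h x \<partial>M)"
    if "A \<in> sets F" "h \<in> borel_measurable M" for A h
    using nn_cond_exp_intg[of "indicator A" h] that by (simp add: mult.commute)
  show ?thesis
  proof (intro iffI ballI)
    fix A assume "AE x in M. nn_cond_exp M F f x = nn_cond_exp M F g x" and A: "A \<in> sets F"
    then have "(\<integral>\<^sup>+x\<in>A. nn_cond_exp M F f x \<partial>M) = (\<integral>\<^sup>+x\<in>A. nn_cond_exp M F g x \<partial>M)"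
      by (intro nn_integral_cong_AE) auto
    then show "(\<integral>\<^sup>+x\<in>A. f x \<partial>M) = (\<integral>\<^sup>+x\<in>A. g x \<partial>M)"
      using int A by simp
  next
    assume "\<forall>A\<in>sets F. (\<integral>\<^sup>+x\<in>A. f x \<partial>M) = (\<integral>\<^sup>+x\<in>A. g x \<partial>M)"
    then show "AE x in M. nn_cond_exp M F f x = nn_cond_exp M F g x"
      using int by (intro nn_cond_exp_charact) auto
  qed
qed

lemma AE_eq_of_le_nn_integral_eq:
  fixes p q :: "'a \<Rightarrow> ennreal"
  assumes [measurable]: "p \<in> borel_measurable M" "q \<in> borel_measurable M"
    and le: "\<And>x. q x \<le> p x" and eq: "(\<integral>\<^sup>+x. q x \<partial>M) = (\<integral>\<^sup>+x. p x \<partial>M)"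
    and fin: "(\<integral>\<^sup>+x. p x \<partial>M) < \<top>"
  shows "AE x in M. q x = p x"
proof -
  have "(\<integral>\<^sup>+x. p x - q x \<partial>M) = (\<integral>\<^sup>+x. p x \<partial>M) - (\<integral>\<^sup>+x. q x \<partial>M)"
    using le fin by (intro nn_integral_diff) (auto simp: eq)
  also have "\<dots> = 0"
    using fin by (simp add: eq)
  finally have "AE x in M. p x - q x = 0"
    by (subst (asm) nn_integral_0_iff_AE) auto
  then show ?thesis
  proof eventually_elim
    case (elim x)
    then show ?case
      using le[of x] by (auto simp: diff_eq_0_iff_ennreal)
  qed
qed

lemma nn_set_integral_vimage:
  "(\<integral>\<^sup>+\<omega>\<in>X -` A \<inter> space M. h \<omega> \<partial>M) = (\<integral>\<^sup>+\<omega>. indicator A (X \<omega>) * h \<omega> \<partial>M)"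
  by (intro nn_integral_cong) (auto simp: indicator_def)

lemma cond_exp_invariant_eq_iff:
  fixes X :: "'a \<Rightarrow> 'm::metric_space rooted"
  assumes "prob_space M" and X [measurable]: "X \<in> M \<rightarrow>\<^sub>M borel"
    and [measurable]: "f \<in> borel_measurable M" "g \<in> borel_measurable M"
  shows "(AE \<omega> in M. nn_cond_exp M (invariant_algebra M X) f \<omega> = nn_cond_exp M (invariant_algebra M X) g \<omega>) \<longleftrightarrow>
    (\<forall>A\<in>invariant_sets. (\<integral>\<^sup>+\<omega>. indicator A (X \<omega>) * f \<omega> \<partial>M) = (\<integral>\<^sup>+\<omega>. indicator A (X \<omega>) * g \<omega> \<partial>M))"
proof -
  interpret prob_space M by fact
  interpret finite_measure_subalgebra M "invariant_algebra M X"
    by unfold_locales (rule subalgebra_invariant_algebra[OF X])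
  show ?thesis
    unfolding nn_cond_exp_eq_iff[OF assms(3,4)] sets_invariant_algebra
      nn_set_integral_vimage[symmetric] by blast
qed

text \<open>The greedy transport balances. Let \<open>D\<close> be the networks with some supply left over; there every
  demand is met, and off \<open>D\<close> every supply is used up. On an invariant set where \<open>f\<close> and \<open>g\<close> have the
  same finite integral, the mass sent and the mass received also have equal integrals. Inside \<open>D\<close>
  the mass received is \<open>g\<close>, so the mass sent has the integral of \<open>f\<close> and cannot fall short of \<open>f\<close>;
  outside \<open>D\<close> the same holds with the two roles exchanged. The sets \<open>A k\<close> exhaust the
  networks by sets of finite integral.\<close>

lemma balancing_of_equal_integrals:
  fixes X :: "'a \<Rightarrow> 'm::metric_space rooted" and f g :: "'m rooted \<Rightarrow> ennreal"
  assumes uni: "unimodular M X" and X [measurable]: "X \<in> M \<rightarrow>\<^sub>M borel"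
    and f [measurable]: "f \<in> borel_measurable borel" and f_fin: "\<And>x. f x < \<top>"
    and g [measurable]: "g \<in> borel_measurable borel" and g_fin: "\<And>x. g x < \<top>"
    and eq: "\<And>A. A \<in> invariant_sets \<Longrightarrow>
      (\<integral>\<^sup>+\<omega>. indicator A (X \<omega>) * f (X \<omega>) \<partial>M) = (\<integral>\<^sup>+\<omega>. indicator A (X \<omega>) * g (X \<omega>) \<partial>M)"
    and A: "range A \<subseteq> invariant_sets" "\<And>k. (\<integral>\<^sup>+\<omega>. indicator (A k) (X \<omega>) * f (X \<omega>) \<partial>M) < \<top>"
    and cover: "AE \<omega> in M. X \<omega> \<in> (\<Union>k :: nat. A k)"
  obtains T where "T \<in> borel_measurable borel" "\<And>y. T y < \<top>"
    "AE \<omega> in M. \<forall>y. src y = X \<omega> \<longrightarrow> out_sum T (tgt y) = f (tgt y) \<and> in_sum T (tgt y) = g (tgt y)"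
proof -
  obtain T where T [measurable]: "T \<in> borel_measurable borel" and T_fin: "\<And>y. T y < \<top>"
    and out_le: "\<And>x. out_sum T x \<le> f x" and in_le: "\<And>x. in_sum T x \<le> g x"
    and maximal: "\<And>y. out_sum T (src y) = f (src y) \<or> in_sum T (tgt y) = g (tgt y)"
    using maximal_transport[OF f f_fin g g_fin] by blast
  interpret sigma_algebra UNIV "invariant_sets :: 'm rooted set set"
    by (rule sigma_algebra_invariant_sets)
  have inv_borel: "B \<in> sets borel" if "B \<in> invariant_sets" for B :: "'m rooted set"
    using that by (simp add: invariant_sets_iff)
  define D where "D = {x. out_sum (\<lambda>y. f (tgt y) - out_sum T (tgt y)) x \<noteq> 0}"
  have D_rclass: "rclass G u \<in> D \<longleftrightarrow> (\<exists>v\<in>verts G. out_sum T (rclass G v) \<noteq> f (rclass G v))"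
    if "rooted_network (G, u)" for G u
  proof -
    have "f x - out_sum T x = 0 \<longleftrightarrow> out_sum T x = f x" for x
      using out_le[of x] by (auto simp: diff_eq_0_iff_ennreal f_fin)
    then show ?thesis
      using that by (simp add: D_def out_sum_zero_iff)
  qed
  have D: "D \<in> invariant_sets"
    unfolding invariant_sets_iff
  proof (intro conjI allI)
    show "D \<in> sets borel"
      unfolding D_def by measurable
    fix y :: "'m birooted"
    show "src y \<in> D \<longleftrightarrow> tgt y \<in> D"
      by (cases y rule: birooted_cases) (simp add: D_rclass)
  qed
  have on_D: "in_sum T x = g x" if x: "x \<in> D" for x
  proof (cases x rule: rooted_cases)
    case (1 G u)
    then obtain v where "v \<in> verts G" "out_sum T (rclass G v) \<noteq> f (rclass G v)"
      using x D_rclass by blast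
    then show ?thesis
      using maximal[of "brclass G v u"] 1 by simp
  qed
  have off_D: "out_sum T x = f x" if "x \<notin> D" for x
    using that D_rclass by (cases x rule: rooted_cases) auto
  have root: "AE \<omega> in M. X \<omega> \<in> A k \<longrightarrow> out_sum T (X \<omega>) = f (X \<omega>) \<and> in_sum T (X \<omega>) = g (X \<omega>)" for k
  proof -
    let ?I = "\<lambda>B h. \<integral>\<^sup>+\<omega>. indicator B (X \<omega>) * h (X \<omega>) \<partial>M"
    have Ak: "A k \<in> invariant_sets"
      using A(1) by auto
    have fin: "?I (A k \<inter> B) f < \<top>" for B
      by (rule le_less_trans[OF _ A(2)[of k]]) (auto intro!: nn_integral_mono simp: indicator_def)
    have 1: "A k \<inter> D \<in> invariant_sets" and 2: "A k \<inter> - D \<in> invariant_sets"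
      using Ak D by (auto simp: Compl_eq_Diff_UNIV)
    note [measurable] = inv_borel[OF 1] inv_borel[OF 2]
    have "?I (A k \<inter> D) (out_sum T) = ?I (A k \<inter> D) (in_sum T)"
      by (rule mass_transport_invariant[OF uni T T_fin 1])
    also have "\<dots> = ?I (A k \<inter> D) g"
      using on_D by (intro nn_integral_cong) (auto simp: indicator_def)
    also have "\<dots> = ?I (A k \<inter> D) f"
      by (rule eq[OF 1, symmetric])
    finally have AE_D: "AE \<omega> in M. indicator (A k \<inter> D) (X \<omega>) * out_sum T (X \<omega>) =
        indicator (A k \<inter> D) (X \<omega>) * f (X \<omega>)"
      using fin by (intro AE_eq_of_le_nn_integral_eq) (auto intro!: mult_left_mono out_le)
    have "?I (A k \<inter> - D) (in_sum T) = ?I (A k \<inter> - D) (out_sum T)"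
      by (rule mass_transport_invariant[OF uni T T_fin 2, symmetric])
    also have "\<dots> = ?I (A k \<inter> - D) f"
      using off_D by (intro nn_integral_cong) (auto simp: indicator_def)
    also have "\<dots> = ?I (A k \<inter> - D) g"
      by (rule eq[OF 2])
    finally have "AE \<omega> in M. indicator (A k \<inter> - D) (X \<omega>) * in_sum T (X \<omega>) =
        indicator (A k \<inter> - D) (X \<omega>) * g (X \<omega>)"
      using fin[of "- D"] eq[OF 2]
      by (intro AE_eq_of_le_nn_integral_eq) (auto intro!: mult_left_mono in_le)
    with AE_D show ?thesis
    proof eventually_elim
      case (elim \<omega>)
      then show ?case
        using on_D off_D by (cases "X \<omega> \<in> D") (auto simp: indicator_def)
    qed
  qed
  define P where "P = {x. out_sum T x = f x \<and> in_sum T x = g x}"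
  have P: "P \<in> sets borel"
    unfolding P_def by measurable
  have "AE \<omega> in M. \<forall>k. X \<omega> \<in> A k \<longrightarrow> out_sum T (X \<omega>) = f (X \<omega>) \<and> in_sum T (X \<omega>) = g (X \<omega>)"
    unfolding AE_all_countable using root by blast
  with cover have "AE \<omega> in M. X \<omega> \<in> P"
    unfolding P_def by eventually_elim auto
  from AE_root_imp_AE_all_vertices[OF uni X P this] show ?thesis
    by (intro that[OF T T_fin]) (simp add: P_def)
qed


theorem theorem4:
  fixes M :: "'a measure" and X :: "'a \<Rightarrow> 'm::polish_space rooted"
    and w1 w2 :: "'m rooted \<Rightarrow> real"
  assumes "prob_space M" and "X \<in> M \<rightarrow>\<^sub>M borel" and "unimodular M X"
    and "w1 \<in> borel_measurable borel" and "\<And>x. 0 \<le> w1 x"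
    and "w2 \<in> borel_measurable borel" and "\<And>x. 0 \<le> w2 x"
    and "AE \<omega> in M. nn_cond_exp M (invariant_algebra M X) (\<lambda>\<omega>. ennreal (w1 (X \<omega>))) \<omega> < \<infinity>"
  shows "(\<exists>T :: 'm birooted \<Rightarrow> real. T \<in> borel_measurable borel \<and> (\<forall>x. 0 \<le> T x) \<and>
            as_balances M X T w1 w2) \<longleftrightarrow>
         (AE \<omega> in M. nn_cond_exp M (invariant_algebra M X) (\<lambda>\<omega>. ennreal (w1 (X \<omega>))) \<omega> =
                     nn_cond_exp M (invariant_algebra M X) (\<lambda>\<omega>. ennreal (w2 (X \<omega>))) \<omega>)"
proof -
  note X [measurable] = assms(2) and uni = assms(3)
  define f g where "f x = ennreal (w1 x)" and "g x = ennreal (w2 x)" for x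
  have f [measurable]: "f \<in> borel_measurable borel" and g [measurable]: "g \<in> borel_measurable borel"
    using assms(4,6) by (auto simp: f_def[abs_def] g_def[abs_def])
  let ?I = "\<lambda>A h. \<integral>\<^sup>+\<omega>. indicator A (X \<omega>) * h (X \<omega>) \<partial>M"
  let ?E = "nn_cond_exp M (invariant_algebra M X) (\<lambda>\<omega>. f (X \<omega>))"
  have ii_iff: "(AE \<omega> in M. ?E \<omega> = nn_cond_exp M (invariant_algebra M X) (\<lambda>\<omega>. g (X \<omega>)) \<omega>) \<longleftrightarrow>
      (\<forall>A\<in>invariant_sets. ?I A f = ?I A g)"
    by (intro cond_exp_invariant_eq_iff[OF assms(1) X]) measurable
  show ?thesis
    unfolding f_def[symmetric] g_def[symmetric] ii_iff
  proof (intro iffI ballI)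
    fix A :: "'m rooted set"
    assume "\<exists>T :: 'm birooted \<Rightarrow> real. T \<in> borel_measurable borel \<and> (\<forall>x. 0 \<le> T x) \<and> as_balances M X T w1 w2"
      and A: "A \<in> invariant_sets"
    then obtain T :: "'m birooted \<Rightarrow> real" where [measurable]: "T \<in> borel_measurable borel"
      and bal: "as_balances M X T w1 w2"
      by blast
    let ?T = "\<lambda>y. ennreal (T y)"
    have AE: "AE \<omega> in M. out_sum ?T (X \<omega>) = f (X \<omega>) \<and> in_sum ?T (X \<omega>) = g (X \<omega>)"
      using bal unfolding as_balances_def
    proof eventually_elim
      case (elim \<omega>)
      obtain G u where "rooted_network (G, u)" "X \<omega> = rclass G u"
        by (rule rooted_cases)
      then show ?case
        using elim by (auto simp: balances_def f_def g_def mass_out_eq_out_sum mass_in_eq_in_sum)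
    qed
    have "?I A f = ?I A (out_sum ?T)"
      using AE by (intro nn_integral_cong_AE) auto
    also have "\<dots> = ?I A (in_sum ?T)"
      by (rule mass_transport_invariant[OF uni _ _ A]) auto
    also have "\<dots> = ?I A g"
      using AE by (intro nn_integral_cong_AE) auto
    finally show "?I A f = ?I A g" .
  next
    assume eq: "\<forall>A\<in>invariant_sets. ?I A f = ?I A g"
    interpret prob_space M by fact
    interpret finite_measure_subalgebra M "invariant_algebra M X"
      by unfold_locales (rule subalgebra_invariant_algebra[OF X])
    have space: "space (invariant_algebra M X) = space M"
      by (simp add: invariant_algebra_def)
    \<comment> \<open>where the conditional expectation is at most \<open>k\<close>, the integral of \<open>f\<close> is at most \<open>k\<close>\<close>
    have "\<exists>A\<in>invariant_sets. X -` A \<inter> space M = {\<omega> \<in> space M. ?E \<omega> \<le> of_nat k}" for k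
    proof -
      have "{\<omega> \<in> space (invariant_algebra M X). ?E \<omega> \<le> of_nat k} \<in> sets (invariant_algebra M X)"
        by measurable
      then show ?thesis
        unfolding space sets_invariant_algebra by blast
    qed
    then obtain A where A: "A k \<in> invariant_sets" "X -` A k \<inter> space M = {\<omega> \<in> space M. ?E \<omega> \<le> of_nat k}" for k
      by metis
    have A_fin: "?I (A k) f < \<top>" for k
    proof -
      have ind: "(\<lambda>\<omega>. indicator (X -` A k \<inter> space M) \<omega> :: ennreal) \<in> borel_measurable (invariant_algebra M X)"
        using A(1) by (intro borel_measurable_indicator) (auto simp: sets_invariant_algebra)
      have "?I (A k) f = (\<integral>\<^sup>+\<omega>. indicator (X -` A k \<inter> space M) \<omega> * f (X \<omega>) \<partial>M)"
        by (intro nn_integral_cong) (auto simp: indicator_def)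
      also have "\<dots> = (\<integral>\<^sup>+\<omega>. indicator (X -` A k \<inter> space M) \<omega> * ?E \<omega> \<partial>M)"
        by (rule nn_cond_exp_intg[OF ind, symmetric]) measurable
      also have "\<dots> \<le> (\<integral>\<^sup>+\<omega>. of_nat k \<partial>M)"
        unfolding A(2) by (intro nn_integral_mono) (auto simp: indicator_def)
      also have "\<dots> < \<top>"
        by (simp add: emeasure_space_1 of_nat_less_top)
      finally show ?thesis .
    qed
    have A_cover: "AE \<omega> in M. X \<omega> \<in> (\<Union>k. A k)"
      using assms(8) AE_space
    proof eventually_elim
      case (elim \<omega>)
      then have "?E \<omega> < \<top>"
        by (simp add: f_def)
      then obtain k :: nat where "?E \<omega> \<le> of_nat k"
        by (meson ennreal_Ex_less_of_nat less_imp_le)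
      then have "\<omega> \<in> X -` A k \<inter> space M"
        unfolding A(2) using elim by simp
      then show ?case
        by auto
    qed
    have "range A \<subseteq> invariant_sets" "f x < \<top>" "g x < \<top>" for x
      using A by (auto simp: f_def g_def)
    then obtain T where [measurable]: "T \<in> borel_measurable borel" and fin: "\<And>y. T y < \<top>"
      and bal: "AE \<omega> in M. \<forall>y. src y = X \<omega> \<longrightarrow> out_sum T (tgt y) = f (tgt y) \<and> in_sum T (tgt y) = g (tgt y)"
      using balancing_of_equal_integrals[OF uni X f _ g _ eq[rule_format] _ A_fin A_cover] by blast
    define T' where "T' y = enn2real (T y)" for y
    have T': "ennreal (T' y) = T y" for y
      using fin by (simp add: T'_def)
    have "as_balances M X T' w1 w2"
      using bal unfolding as_balances_def
    proof (eventually_elim, intro allI impI)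
      fix \<omega> G u
      assume *: "\<forall>y. src y = X \<omega> \<longrightarrow> out_sum T (tgt y) = f (tgt y) \<and> in_sum T (tgt y) = g (tgt y)"
        and G: "rooted_network (G, u)" and x: "X \<omega> = rclass G u"
      show "balances T' G (\<lambda>v. w1 (rclass G v)) (\<lambda>v. w2 (rclass G v))"
        unfolding balances_def
      proof (intro ballI)
        fix v assume "v \<in> verts G"
        then show "mass_out T' G v = ennreal (w1 (rclass G v)) \<and> mass_in T' G v = ennreal (w2 (rclass G v))"
          using *[rule_format, of "brclass G u v"] G x
          by (simp add: mass_out_eq_out_sum mass_in_eq_in_sum T' f_def g_def)
      qed
    qed
    moreover have "T' \<in> borel_measurable borel" "\<forall>y. 0 \<le> T' y"
      by (auto simp: T'_def[abs_def])
    ultimately show "\<exists>T :: 'm birooted \<Rightarrow> real. T \<in> borel_measurable borel \<and> (\<forall>x. 0 \<le> T x) \<and> as_balances M X T w1 w2"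
      by blast
  qed
qed

end
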